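(* Let $T_0>0$ and, for $\mathrm{Re}\,\phi\neq0$, let $$\rho_I(\phi)=\frac{T_0^4}{16\pi^2}\sum_{n=1}^\infty\frac{3\phi^4}{\sinh^4(n\phi/2)},\quad p_I(\phi)=\frac{T_0^4}{16\pi^2}\sum_{n=1}^\infty\frac{\phi^4\cosh(n\phi)}{\sinh^4(n\phi/2)},\quad \mathcal A_I(\phi)=\frac{T_0^4}{16\pi^2}\sum_{n=1}^\infty\frac{2\phi^2}{\sinh^2(n\phi/2)}.$$ These functions have analytic distillates at $\phi=0$ which are polynomials in $\phi$, and the values $\rho,p,\mathcal A$ of these polynomials at $\phi=ia/T_0$ ($a\in\mathbb R$) are $$\rho=T_0^4\Big(\frac{\pi^2}{30}+\frac{a^2}{12T_0^2}-\frac{11a^4}{480\pi^2T_0^4}\Big),\quad p=T_0^4\Big(\frac{\pi^2}{90}-\frac{a^2}{18T_0^2}+\frac{19a^4}{1440\pi^2T_0^4}\Big),\quad \mathcal A=T_0^4\Big(\frac1{12}-\frac{a^2}{48\pi^2T_0^2}\Big).$$ All three vanish when $a/T_0=2\pi$.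
   Context: $\rho,p,\mathcal A$ are the coefficients at $x=0$ of the thermal expectation value $\rho\,u^\mu u^\nu-p(g^{\mu\nu}-u^\mu u^\nu)+\mathcal A\,\alpha^\mu\alpha^\nu$ of the canonical stress-energy tensor of the free massless neutral scalar field with density operator proportional to $\exp[-\hat H/T_0+a\hat K_z/T_0]$. Analytic distillate: let $f$ be a function on a domain $D\subset\mathbb C$ and $z_0\in\bar D$. Suppose that $D$ is a union of subsets $D_i$ in each of which $f$ has an asymptotic power series $f(z)\sim\sum_n a_n^{(i)}(z-z_0)^n$ as $z\to z_0$, $z\in D_i$ ($n$ integer, possibly finitely many negative values). Put $\bar a_n=a_n^{(i)}$ if $a^{(i)}_n=a^{(j)}_n$ for all $i,j$, and $\bar a_n=0$ otherwise. If $\sum_{n\ge0}\bar a_n(z-z_0)^n$ has positive radius of convergence, its sum is the analytic distillate $\mathrm{dist}_{z_0}f$. Here $D=\{\mathrm{Re}\,\phi\neq0\}$, and the subsets $D_i$ are the sectors $\{0<|\phi|,\ |\arg\phi|\le\frac\pi2-\delta\}$ and $\{0<|\phi|,\ |\arg(-\phi)|\le\frac\pi2-\delta\}$, $0<\delta<\pi/2$. *)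

theory Defs
  imports "HOL-Complex_Analysis.Complex_Analysis" "HOL-Library.Landau_Symbols"
begin

(* Poincare-type expansion f(z) ~ sum_n a_n (z - z0)^n as z -> z0, z in S.  A formal Laurent
   series has only finitely many nonzero coefficients of negative index, and the partial sums
   start at its subdegree.  The limit-point condition is what "z -> z0 in S" presupposes; it
   makes the coefficients unique. *)
definition has_asymptotic_series ::
  "(complex \<Rightarrow> complex) \<Rightarrow> complex fls \<Rightarrow> complex \<Rightarrow> complex set \<Rightarrow> bool" where
  "has_asymptotic_series f A z0 S \<longleftrightarrow>
     z0 islimpt S \<and>
     (\<forall>N::int. (\<lambda>z. f z - (\<Sum>n\<in>{fls_subdegree A..N}. fls_nth A n * (z - z0) powi n))
                \<in> o[at z0 within S](\<lambda>z. (z - z0) powi N))"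

(* The family of subsets D_i is given as a set of sets, and A S is the expansion on S. *)
definition common_coeffs :: "complex set set \<Rightarrow> (complex set \<Rightarrow> complex fls) \<Rightarrow> complex fps" where
  "common_coeffs \<S> A = Abs_fps (\<lambda>n.
     if \<forall>S\<in>\<S>. \<forall>S'\<in>\<S>. fls_nth (A S) (int n) = fls_nth (A S') (int n)
     then fls_nth (A (SOME S. S \<in> \<S>)) (int n)
     else 0)"

(* The distillate is a function on the disc of convergence only, so g is unconstrained
   outside that disc. *)
definition has_analytic_distillate ::
  "(complex \<Rightarrow> complex) \<Rightarrow> complex set \<Rightarrow> complex set set \<Rightarrow> complex \<Rightarrow> (complex \<Rightarrow> complex) \<Rightarrow> bool" where
  "has_analytic_distillate f D \<S> z0 g \<longleftrightarrow>
     D = \<Union>\<S> \<and> z0 \<in> closure D \<and>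
     (\<exists>A. (\<forall>S\<in>\<S>. has_asymptotic_series f (A S) z0 S) \<and>
          fps_conv_radius (common_coeffs \<S> A) > 0 \<and>
          (\<forall>z\<in>eball z0 (fps_conv_radius (common_coeffs \<S> A)).
             g z = eval_fps (common_coeffs \<S> A) (z - z0)))"

definition D_thermal :: "complex set" where
  "D_thermal = {\<phi>. Re \<phi> \<noteq> 0}"

definition right_sector :: "real \<Rightarrow> complex set" where
  "right_sector \<delta> = {\<phi>. 0 < norm \<phi> \<and> \<bar>Arg \<phi>\<bar> \<le> pi / 2 - \<delta>}"

definition left_sector :: "real \<Rightarrow> complex set" where
  "left_sector \<delta> = {\<phi>. 0 < norm \<phi> \<and> \<bar>Arg (- \<phi>)\<bar> \<le> pi / 2 - \<delta>}"

definition thermal_sectors :: "complex set set" where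
  "thermal_sectors = right_sector ` {0<..<pi/2} \<union> left_sector ` {0<..<pi/2}"

definition rho_I :: "real \<Rightarrow> complex \<Rightarrow> complex" where
  "rho_I T0 \<phi> = of_real (T0 ^ 4 / (16 * pi\<^sup>2)) *
     (\<Sum>k. let n = of_nat (Suc k) in 3 * \<phi> ^ 4 / sinh (n * \<phi> / 2) ^ 4)"

definition p_I :: "real \<Rightarrow> complex \<Rightarrow> complex" where
  "p_I T0 \<phi> = of_real (T0 ^ 4 / (16 * pi\<^sup>2)) *
     (\<Sum>k. let n = of_nat (Suc k) in \<phi> ^ 4 * cosh (n * \<phi>) / sinh (n * \<phi> / 2) ^ 4)"

definition A_I :: "real \<Rightarrow> complex \<Rightarrow> complex" where
  "A_I T0 \<phi> = of_real (T0 ^ 4 / (16 * pi\<^sup>2)) *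
     (\<Sum>k. let n = of_nat (Suc k) in 2 * \<phi> ^ 2 / sinh (n * \<phi> / 2) ^ 2)"

end

(* Write rho_I, p_I, A_I through csch_sum j phi = sum_{n >= 1} sinh(n phi / 2)^(-j), j = 2, 4.  Up to
   constants these are sums over n of the row sums eisenstein_row 2 and eisenstein_row 4 at n tau, where
   tau = i phi / (2 pi), i.e. sums over the lattice Z tau + Z.  Exchanging the order of summation
   replaces tau by -1 / tau; this is free in weight 4 and costs the term pi i / tau in weight 2.
   So on Re phi > 0, phi^j csch_sum j phi is a polynomial plus csch sums at the dual point
   4 pi^2 / phi, which decay faster than any power of phi in each sector.  All three functions are
   even, so the expansions on the two sides differ only in their odd coefficients, and the
   distillate is the even part of the polynomial. *)
theory Submission
  imports Defs
begin

section \<open>Partial fractions of the cotangent\<close>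

text \<open>The obstacle is weight 2, where the lattice series converges only conditionally. Its
  terms are compared with differences in \<open>k\<close> of an explicit family \<open>u\<close>,
  chosen so that what is left has order -3 and can be summed in either order. The differences sum to
  0 along each row, but their column sums add up to \<open>- (pi * \<i> / t)\<close>, because
  \<open>cot\<close> tends to \<open>\<i>\<close> deep in the lower half-plane; this mismatch is the
  extra term. It is the only source of odd powers: \<open>- 2 * \<phi>\<close> in weight 2, and
  \<open>4 / 3 * \<phi> ^ 3\<close> for the fourth powers, since a row of weight 4 mixes inverse
  fourth and second powers of the sine. The even terms come from zeta(2) and zeta(4). The partial
  fraction expansions all derive from Euler's reflection formula for Gamma.\<close>

lemma sin_pi_times_nonzero:
  fixes z :: complex
  assumes "z \<notin> \<int>"
  shows "sin (pi * z) \<noteq> 0"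
  using assms by (auto simp: sin_eq_0 Ints_def)

text \<open>Differentiate Euler's formula \<open>Gamma z * Gamma (1 - z) = pi / sin (pi * z)\<close>
  and cancel the product.\<close>

lemma Digamma_reflection:
  fixes z :: complex
  assumes "z \<notin> \<int>"
  shows "Digamma (1 - z) - Digamma z = pi * cot (pi * z)"
proof -
  have z: "z \<notin> \<int>\<^sub>\<le>\<^sub>0" "1 - z \<notin> \<int>\<^sub>\<le>\<^sub>0"
    using assms nonpos_Ints_Int[of z] nonpos_Ints_Int[of "1 - z"]
      Ints_diff[of 1 "1 - z"] by auto
  have s: "sin (pi * z) \<noteq> 0"
    using assms by (rule sin_pi_times_nonzero)
  have eq: "(\<lambda>z::complex. Gamma z * Gamma (1 - z)) = (\<lambda>z. of_real pi / sin (of_real pi * z))"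
    by (simp add: Gamma_reflection_complex)
  have "((\<lambda>z. Gamma z * Gamma (1 - z)) has_field_derivative
          Gamma z * Gamma (1 - z) * (Digamma z - Digamma (1 - z))) (at z)"
    using z by (auto intro!: derivative_eq_intros simp: algebra_simps)
  moreover have "((\<lambda>z. of_real pi / sin (of_real pi * z)) has_field_derivative
          - (pi / sin (pi * z)) * (pi * cot (pi * z))) (at z)"
    using s by (auto intro!: derivative_eq_intros simp: cot_def power2_eq_square)
  ultimately have "Gamma z * Gamma (1 - z) * (Digamma z - Digamma (1 - z)) =
          - (pi / sin (pi * z)) * (pi * cot (pi * z))"
    unfolding eq by (rule DERIV_unique)
  then have "pi / sin (pi * z) * (Digamma z - Digamma (1 - z)) =
          pi / sin (pi * z) * - (pi * cot (pi * z))"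
    by (simp add: Gamma_reflection_complex)
  then have "Digamma z - Digamma (1 - z) = - (pi * cot (pi * z))"
    using s by (subst (asm) mult_left_cancel) auto
  then show ?thesis by (simp add: algebra_simps)
qed

lemma open_compl_Ints: "open (- (\<int> :: complex set))"
  by (simp add: closed_Ints open_Compl)

text \<open>The complement of the integers is open, so an identity valid there may be differentiated
  at each of its points. The reflection identities are differentiated repeatedly in this
  way.\<close>

lemma DERIV_unique_compl_Ints:
  fixes f g :: "complex \<Rightarrow> complex"
  assumes "\<And>w. w \<notin> \<int> \<Longrightarrow> f w = g w" "z \<notin> \<int>"
    and "(f has_field_derivative f') (at z)" "(g has_field_derivative g') (at z)"
  shows "f' = g'"
proof -
  have "(g has_field_derivative f') (at z)"
    by (rule has_field_derivative_transform_within_open[OF assms(3) open_compl_Ints])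
       (use assms in auto)
  then show ?thesis using assms(4) DERIV_unique by blast
qed

text \<open>One and three differentiations of the cotangent reflection. Each derivative of the term
  in \<open>1 - z\<close> flips its sign, so sums and differences alternate; the sums, at odd
  orders, are what bilateral series of even weight need.\<close>

lemma Polygamma_reflection_1_3:
  fixes z :: complex
  assumes "z \<notin> \<int>"
  shows "Polygamma 1 z + Polygamma 1 (1 - z) = pi\<^sup>2 / sin (pi * z) ^ 2"
    and "Polygamma 3 z + Polygamma 3 (1 - z) =
           pi ^ 4 * (6 / sin (pi * z) ^ 4 - 4 / sin (pi * z) ^ 2)"
proof -
  have nonint: "w \<notin> \<int>\<^sub>\<le>\<^sub>0" "1 - w \<notin> \<int>\<^sub>\<le>\<^sub>0" "sin (pi * w) \<noteq> 0" if "w \<notin> \<int>" for w :: complex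
    using that nonpos_Ints_Int[of w] nonpos_Ints_Int[of "1 - w"]
      Ints_diff[of 1 "1 - w"] sin_pi_times_nonzero[OF that] by auto
  have d1: "Polygamma 1 w + Polygamma 1 (1 - w) = pi\<^sup>2 / sin (pi * w) ^ 2"
    if w: "w \<notin> \<int>" for w :: complex
  proof -
    have D1: "((\<lambda>z. Digamma (1 - z) - Digamma z) has_field_derivative
            - (Polygamma 1 w + Polygamma 1 (1 - w))) (at w)"
      using nonint[OF w] by (auto intro!: derivative_eq_intros)
    have D2: "((\<lambda>z. pi * cot (pi * z)) has_field_derivative - (pi\<^sup>2 / sin (pi * w) ^ 2)) (at w)"
    proof -
      let ?s = "sin (pi * w)" and ?c = "cos (pi * w)"
      have "((\<lambda>z. pi * (cos (pi * z) / sin (pi * z)) :: complex) has_field_derivative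
              pi * ((- ?s * pi * ?s - ?c * (?c * pi)) / (?s * ?s))) (at w)"
        using nonint[OF w] by (auto intro!: derivative_eq_intros simp: algebra_simps)
      also have "pi * ((- ?s * pi * ?s - ?c * (?c * pi)) / (?s * ?s)) =
          - (pi\<^sup>2 * (?s\<^sup>2 + ?c\<^sup>2) / ?s\<^sup>2)"
        using nonint[OF w]
        by (simp add: field_simps power2_eq_square del: sin_cos_squared_add3)
      finally show ?thesis by (simp add: cot_def)
    qed
    have "- (Polygamma 1 w + Polygamma 1 (1 - w)) = - (pi\<^sup>2 / sin (pi * w) ^ 2)"
      by (rule DERIV_unique_compl_Ints[OF _ w D1 D2]) (rule Digamma_reflection)
    then show ?thesis by (simp only: neg_equal_iff_equal)
  qed
  have d2: "Polygamma 2 w - Polygamma 2 (1 - w) = - 2 * pi ^ 3 * cos (pi * w) / sin (pi * w) ^ 3"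
    if w: "w \<notin> \<int>" for w :: complex
  proof (rule DERIV_unique_compl_Ints[OF d1 w])
    show "((\<lambda>z. Polygamma 1 z + Polygamma 1 (1 - z)) has_field_derivative
            Polygamma 2 w - Polygamma 2 (1 - w)) (at w)"
      using nonint[OF w] by (auto intro!: derivative_eq_intros simp: numeral_2_eq_2)
    show "((\<lambda>z. (pi\<^sup>2 / sin (pi * z) ^ 2 :: complex)) has_field_derivative
            - 2 * pi ^ 3 * cos (pi * w) / sin (pi * w) ^ 3) (at w)"
      using nonint[OF w]
      by (auto intro!: derivative_eq_intros simp: field_simps power_numeral_reduce)
  qed
  have d3: "Polygamma 3 w + Polygamma 3 (1 - w) =
              2 * pi ^ 4 / sin (pi * w) ^ 2 + 6 * pi ^ 4 * cos (pi * w) ^ 2 / sin (pi * w) ^ 4"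
    if w: "w \<notin> \<int>" for w :: complex
  proof (rule DERIV_unique_compl_Ints[OF d2 w])
    show "((\<lambda>z. Polygamma 2 z - Polygamma 2 (1 - z)) has_field_derivative
            Polygamma 3 w + Polygamma 3 (1 - w)) (at w)"
      using nonint[OF w] by (auto intro!: derivative_eq_intros simp: numeral_3_eq_3 numeral_2_eq_2)
    show "((\<lambda>z. - 2 * pi ^ 3 * cos (pi * z) / sin (pi * z) ^ 3 :: complex) has_field_derivative
            2 * pi ^ 4 / sin (pi * w) ^ 2 + 6 * pi ^ 4 * cos (pi * w) ^ 2 / sin (pi * w) ^ 4) (at w)"
      using nonint[OF w]
      by (auto intro!: derivative_eq_intros simp: field_simps power_numeral_reduce)
  qed
  show "Polygamma 1 z + Polygamma 1 (1 - z) = pi\<^sup>2 / sin (pi * z) ^ 2"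
    using d1[OF assms] .
  \<comment> \<open>The third derivative leaves a squared cosine; eliminating it gives, up to the
    factor \<open>fact 3\<close>, the form used in \<open>eisenstein_row\<close>.\<close>
  have pythagoras: "2 * P / s ^ 2 + 6 * P * c ^ 2 / s ^ 4 = P * (6 / s ^ 4 - 4 / s ^ 2)"
    if "s \<noteq> 0" "c ^ 2 = 1 - s ^ 2" for P s c :: complex
    unfolding that(2) using that(1) by (simp add: field_simps power_numeral_reduce)
  show "Polygamma 3 z + Polygamma 3 (1 - z) =
           pi ^ 4 * (6 / sin (pi * z) ^ 4 - 4 / sin (pi * z) ^ 2)"
    unfolding d3[OF assms] using pythagoras[OF nonint(3)[OF assms] cos_squared_eq] by simp
qed

text \<open>The sum of \<open>1 / (z + k) ^ m\<close> over all integers \<open>k\<close>; meaningful only for \<open>m = 2\<close> and \<open>m = 4\<close>.\<close>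

definition eisenstein_row :: "nat \<Rightarrow> complex \<Rightarrow> complex" where
  "eisenstein_row m z = (if m = 2 then of_real pi ^ 2 / sin (of_real pi * z) ^ 2
            else of_real pi ^ 4 * (1 / sin (of_real pi * z) ^ 4 - 2 / 3 / sin (of_real pi * z) ^ 2))"

text \<open>The Polygamma series at \<open>z\<close> and \<open>- z\<close> together run over all
  integers and meet \<open>k = 0\<close> twice; the extra \<open>1 / z ^ m\<close> is the second
  copy. The recurrence moves \<open>- z\<close> to \<open>1 - z\<close>, where reflection applies,
  and the evenness of \<open>m\<close> absorbs the signs.\<close>

lemma eisenstein_row_sums:
  fixes z :: complex
  assumes z: "z \<notin> \<int>" and m: "m = 2 \<or> m = 4"
  shows "(\<lambda>k. 1 / (z + of_nat k) ^ m + 1 / (z - of_nat k) ^ m) sums (eisenstein_row m z + 1 / z ^ m)"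
proof -
  have [simp]: "z \<noteq> 0" using z by auto
  define n where "n = m - 1"
  have n: "m = Suc n" "n > 0" "odd n" using m by (auto simp: n_def)
  have flip: "inverse ((- z + of_nat k) ^ Suc n) = 1 / (z - of_nat k) ^ m" for k
  proof -
    have "(- z + of_nat k) ^ m = (- (z - of_nat k)) ^ m" by simp
    also have "\<dots> = (z - of_nat k) ^ m" using n by (subst power_minus_even) auto
    finally show ?thesis by (simp add: n(1) inverse_eq_divide)
  qed
  have "(\<lambda>k. inverse ((z + of_nat k)^Suc n) + inverse ((- z + of_nat k)^Suc n)) sums
          ((-1) ^ Suc n * Polygamma n z / fact n + (-1) ^ Suc n * Polygamma n (-z) / fact n)"
    by (intro sums_add Polygamma_LIMSEQ) (use n in auto)
  also have "(\<lambda>k. inverse ((z + of_nat k)^Suc n) + inverse ((- z + of_nat k)^Suc n)) =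
      (\<lambda>k. 1 / (z + of_nat k) ^ m + 1 / (z - of_nat k) ^ m)"
    unfolding flip by (simp add: n(1) inverse_eq_divide)
  also have "Polygamma n (- z) = Polygamma n (1 - z) + fact n / z ^ m"
  proof -
    have "(- z) ^ Suc n = z ^ m" using n by (subst power_minus_even) auto
    then show ?thesis
      using Polygamma_plus1[of "-z" n] n(3) by simp
  qed
  also have "(-1) ^ Suc n * Polygamma n z / fact n +
      (-1) ^ Suc n * (Polygamma n (1 - z) + fact n / z ^ m) / fact n =
      (Polygamma n z + Polygamma n (1 - z)) / fact n + 1 / z ^ m"
    using n(3) by (simp add: add_divide_distrib)
  also have "(Polygamma n z + Polygamma n (1 - z)) / fact n = eisenstein_row m z"
    using m Polygamma_reflection_1_3[OF z]
    by (auto simp: n_def eisenstein_row_def fact_numeral field_simps)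
  finally show ?thesis .
qed

section \<open>The value of zeta(4)\<close>

lemma inverse_fourth_powers_sums: "(\<lambda>n. 1 / real (n + 1) ^ 4) sums (pi ^ 4 / 90)"
proof -
  (* The reflection formula at 1/2 gives the sum over the odd integers. *)
  define f where "f = (\<lambda>n. 1 / real (n + 1) ^ 4)"
  have half: "(1/2 :: complex) \<notin> \<int>"
    using fraction_not_in_Ints[of 2 1, where ?'a = complex] by simp
  have "sin (pi * (1/2)) = (1 :: complex)"
    by (metis mult.commute mult_1 of_real_1 of_real_divide of_real_mult of_real_numeral sin_of_real sin_pi_half times_divide_eq_right)
  then have "2 * Polygamma 3 (1/2 :: complex) = 2 * pi ^ 4"
    using Polygamma_reflection_1_3(2)[OF half] by simp
  then have P: "Polygamma 3 (1/2 :: complex) = pi ^ 4" by simp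
  have "(\<lambda>k. inverse ((1/2 + of_nat k) ^ Suc 3)) sums (((-1) ^ Suc 3 * Polygamma 3 (1/2) / fact 3) :: complex)"
    by (rule Polygamma_LIMSEQ) auto
  then have "(\<lambda>k. complex_of_real (inverse ((1/2 + real k) ^ 4))) sums complex_of_real (pi ^ 4 / 6)"
    by (simp add: P fact_numeral)
  then have "(\<lambda>k. inverse ((1/2 + real k) ^ 4)) sums (pi ^ 4 / 6)"
    by (simp only: sums_of_real_iff)
  then have "(\<lambda>k. inverse ((1/2 + real k) ^ 4) / 16) sums (pi ^ 4 / 6 / 16)"
    by (rule sums_divide)
  also have "(\<lambda>k. inverse ((1/2 + real k) ^ 4) / 16) = (\<lambda>k. f (k * 2))"
  proof
    fix k
    have "inverse ((1/2 + real k) ^ 4) / 16 = inverse ((2 * (1/2 + real k)) ^ 4)"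
      by (subst power_mult_distrib) simp
    then show "inverse ((1/2 + real k) ^ 4) / 16 = f (k * 2)"
      by (simp add: f_def inverse_eq_divide algebra_simps)
  qed
  finally have odd: "(\<lambda>k. f (k * 2)) sums (pi ^ 4 / 96)" by simp
  have "summable (\<lambda>n. inverse (real n ^ 4))"
    by (rule inverse_power_summable) simp
  then have "summable (\<lambda>n. inverse (real (Suc n) ^ 4))" by (subst summable_Suc_iff)
  then have f: "f sums suminf f"
    by (intro summable_sums) (simp add: f_def inverse_eq_divide add.commute)
  \<comment> \<open>Index \<open>n * 2\<close> stands for the odd integer 2n + 1 and the next index
    for 2n + 2, whose term is \<open>f n / 16\<close>. Pairing them gives a linear equation for the
    total: S = pi^4 / 96 + S / 16.\<close>
  have "(\<lambda>n. sum f {n * 2..<n * 2 + 2}) sums suminf f"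
    by (rule sums_group[OF f]) simp
  also have "(\<lambda>n. sum f {n * 2..<n * 2 + 2}) = (\<lambda>n. f (n * 2) + f n / 16)"
  proof
    fix n
    have "f (Suc (n * 2)) = 1 / (2 * real (n + 1)) ^ 4"
      by (simp add: f_def algebra_simps)
    also have "\<dots> = f n / 16"
      by (subst power_mult_distrib) (simp add: f_def)
    finally show "sum f {n * 2..<n * 2 + 2} = f (n * 2) + f n / 16"
      by (simp add: numeral_2_eq_2)
  qed
  finally have "(\<lambda>n. f (n * 2) + f n / 16) sums suminf f" .
  moreover have "(\<lambda>n. f (n * 2) + f n / 16) sums (pi ^ 4 / 96 + suminf f / 16)"
    by (intro sums_add sums_divide odd f)
  ultimately have "suminf f = pi ^ 4 / 96 + suminf f / 16"
    by (rule sums_unique2)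
  then have "suminf f = pi ^ 4 / 90" by simp
  with f have "f sums (pi ^ 4 / 90)" by simp
  then show ?thesis by (simp only: f_def)
qed

section \<open>Interchanging lattice sums\<close>

text \<open>The majorant factorises because \<open>(n + 1) (k + 1) \<le> (n + k + 1)\<^sup>2\<close>.\<close>

lemma lattice_distance_bound:
  fixes t :: complex
  assumes "Im t > 0"
  obtains c where "c > 0"
    "\<And>n k. norm (of_nat (Suc n) * t + of_nat k) \<ge> c * sqrt (Suc n) * sqrt (Suc k)"
    "\<And>n k. norm (of_nat (Suc n) * t - of_nat k) \<ge> c * sqrt (Suc n) * sqrt (Suc k)"
proof
  define y where "y = Im t"
  \<comment> \<open>Origin of the constant: \<open>Suc n * y \<le> norm v\<close> is added to
    \<open>y\<close> times the triangle bound for \<open>k\<close>, giving y (k + n + 1) at most (1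
    + y + |t|) |v|.\<close>
  define c where "c = y / (1 + y + norm t)"
  have y: "y > 0" using assms by (simp add: y_def)
  then have pos: "1 + y + norm t > 0" by (simp add: add_pos_nonneg)
  show "c > 0" using y pos by (simp add: c_def)
  have *: "norm v \<ge> c * sqrt (Suc n) * sqrt (Suc k)"
    if im: "Im v = Suc n * y" and k: "real k \<le> norm v + Suc n * norm t" for v n k
  proof -
    have ny: "Suc n * y \<le> norm v" using abs_Im_le_cmod[of v] im by linarith
    have "y * real k \<le> y * norm v + (Suc n * y) * norm t"
      using mult_left_mono[OF k, of y] y by (simp add: algebra_simps)
    also have "\<dots> \<le> y * norm v + norm v * norm t"
      by (intro add_left_mono mult_right_mono ny) auto
    finally have "y * real k + y * Suc n \<le> norm v * (1 + y + norm t)"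
      using ny by (simp add: algebra_simps)
    then have "c * (real k + Suc n) \<le> norm v"
      using pos by (simp add: c_def field_simps)
    moreover have "sqrt (Suc n) * sqrt (Suc k) \<le> real k + Suc n"
    proof -
      have "real (Suc n) * real (Suc k) \<le> (real k + Suc n)\<^sup>2"
        by (simp add: power2_eq_square algebra_simps)
      then show ?thesis
        by (metis real_sqrt_le_mono real_sqrt_mult real_sqrt_unique of_nat_add of_nat_0_le_iff)
    qed
    then have "c * (sqrt (Suc n) * sqrt (Suc k)) \<le> c * (real k + Suc n)"
      using \<open>c > 0\<close> by (intro mult_left_mono) auto
    ultimately show ?thesis by (simp only: mult.assoc)
  qed
  have tri: "real k \<le> norm (of_nat (Suc n) * t + of_nat k) + Suc n * norm t"
            "real k \<le> norm (of_nat (Suc n) * t - of_nat k) + Suc n * norm t" for n k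
    using norm_triangle_ineq4[of "of_nat (Suc n) * t + of_nat k" "of_nat (Suc n) * t"]
      norm_triangle_ineq4[of "of_nat (Suc n) * t" "of_nat (Suc n) * t - of_nat k"]
    by (simp_all add: norm_mult del: of_nat_Suc)
  show "norm (of_nat (Suc n) * t + of_nat k) \<ge> c * sqrt (Suc n) * sqrt (Suc k)" for n k
    by (rule *) (use tri in \<open>auto simp: y_def\<close>)
  show "norm (of_nat (Suc n) * t - of_nat k) \<ge> c * sqrt (Suc n) * sqrt (Suc k)" for n k
    by (rule *) (use tri in \<open>auto simp: y_def\<close>)
qed

text \<open>By the distance bound, a lattice term of order -3 is at most a constant times
  \<open>inv_sqrt_cubed n * inv_sqrt_cubed k\<close>, and 3/2 > 1 makes both factors summable. Order
  -2 would yield only harmonic factors.\<close>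

definition inv_sqrt_cubed :: "nat \<Rightarrow> real" where "inv_sqrt_cubed n = 1 / sqrt (Suc n) ^ 3"

lemma inv_sqrt_cubed_nonneg: "inv_sqrt_cubed n \<ge> 0" by (simp add: inv_sqrt_cubed_def)

lemma summable_inv_sqrt_cubed: "summable inv_sqrt_cubed"
proof -
  have "summable (\<lambda>n. 1 / real n powr (3/2))"
    by (simp add: summable_real_powr_iff powr_minus_divide[symmetric])
  then have "summable (\<lambda>n. 1 / real (Suc n) powr (3/2))"
    by (subst summable_Suc_iff)
  moreover have "1 / real (Suc n) powr (3/2) = inv_sqrt_cubed n" for n
    by (simp add: inv_sqrt_cubed_def powr_half_sqrt[symmetric] powr_realpow[symmetric] powr_powr del: of_nat_Suc)
  ultimately show ?thesis by simp
qed

text \<open>Absolute summability over all pairs gives one unconditional sum, read by rows or by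
  columns; the given ordered sums agree with the unordered ones by uniqueness of limits.\<close>

lemma suminf_swap_product_majorant:
  fixes f :: "nat \<Rightarrow> nat \<Rightarrow> complex" and g :: "nat \<Rightarrow> real"
  assumes bound: "\<And>n k. norm (f n k) \<le> C * g n * g k"
    and g: "summable g" "\<And>n. g n \<ge> 0"
    and a: "\<And>n. f n sums a n" and b: "\<And>k. (\<lambda>n. f n k) sums b k"
  obtains S where "a sums S" "b sums S"
proof -
  have C: "norm (f n k) \<le> \<bar>C\<bar> * g n * g k" for n k
    using bound[of n k] mult_right_mono[OF abs_ge_self[of C], of "g n * g k"] g(2)
    by (simp add: mult.assoc)
  have g_on: "g summable_on UNIV"
    using g by (intro norm_summable_imp_summable_on) simp
  have "(\<lambda>(n,k). (\<bar>C\<bar> * g n) * g k) summable_on UNIV \<times> UNIV"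
  proof (rule summable_on_SigmaI)
    fix n
    have "((\<lambda>k. \<bar>C\<bar> * g n * g k) has_sum (\<bar>C\<bar> * suminf g) * g n) UNIV"
    proof (rule norm_summable_imp_has_sum)
      show "summable (\<lambda>k. norm (\<bar>C\<bar> * g n * g k))"
        using g by (simp add: abs_mult summable_mult)
      show "(\<lambda>k. \<bar>C\<bar> * g n * g k) sums (\<bar>C\<bar> * suminf g * g n)"
        using sums_mult[OF summable_sums[OF g(1)], of "\<bar>C\<bar> * g n"] by (simp add: mult_ac)
    qed
    then show "((\<lambda>k. case (n, k) of (n, k) \<Rightarrow> \<bar>C\<bar> * g n * g k) has_sum (\<bar>C\<bar> * suminf g) * g n) UNIV"
      by simp
  qed (use g g_on in \<open>auto intro!: summable_on_cmult_right\<close>)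
  then have "(\<lambda>p. norm (case p of (n,k) \<Rightarrow> f n k)) summable_on UNIV \<times> UNIV"
    by (rule summable_on_comparison_test) (use C in auto)
  then have sf: "(\<lambda>(n,k). f n k) summable_on UNIV \<times> UNIV"
    by (rule abs_summable_summable)
  then obtain S where S: "((\<lambda>(n,k). f n k) has_sum S) (UNIV \<times> UNIV)"
    by (auto simp: summable_on_def)
  have row: "(f n has_sum a n) UNIV" for n
    using summable_on_SigmaD1[OF sf UNIV_I, of n] a[of n]
    by (metis has_sum_imp_sums has_sum_infsum sums_unique2)
  have S': "((\<lambda>(k,n). f n k) has_sum S) (UNIV \<times> UNIV)"
    using S has_sum_swap[of "\<lambda>(n,k). f n k" UNIV UNIV S] by simp
  then have sf': "(\<lambda>(k,n). f n k) summable_on UNIV \<times> UNIV"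
    by (auto simp: summable_on_def)
  have col: "((\<lambda>n. f n k) has_sum b k) UNIV" for k
    using summable_on_SigmaD1[OF sf' UNIV_I, of k] b[of k]
    by (metis has_sum_imp_sums has_sum_infsum sums_unique2)
  have "(a has_sum S) UNIV"
    by (rule has_sum_SigmaD[OF S]) (use row in auto)
  moreover have "(b has_sum S) UNIV"
    by (rule has_sum_SigmaD[OF S']) (use col in auto)
  ultimately show ?thesis using that has_sum_imp_sums by blast
qed

section \<open>Row and column sums over the lattice\<close>

definition zeta_even :: "nat \<Rightarrow> complex" where
  "zeta_even m = (if m = 2 then of_real (pi\<^sup>2 / 6) else of_real (pi ^ 4 / 90))"

lemma zeta_even_sums:
  assumes "m = 2 \<or> m = 4"
  shows "(\<lambda>n. 1 / of_nat (Suc n) ^ m) sums zeta_even m"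
proof -
  have "(\<lambda>n. complex_of_real (1 / real (n + 1) ^ 2)) sums complex_of_real (pi\<^sup>2 / 6)"
    "(\<lambda>n. complex_of_real (1 / real (n + 1) ^ 4)) sums complex_of_real (pi ^ 4 / 90)"
    unfolding sums_of_real_iff using inverse_squares_sums inverse_fourth_powers_sums by simp_all
  then show ?thesis using assms by (auto simp: zeta_even_def add.commute)
qed

lemma not_Ints_if_Im: "Im z \<noteq> 0 \<Longrightarrow> z \<notin> \<int>"
  by (auto elim: Ints_cases)

text \<open>Folds the points with a positive multiple of \<open>t\<close> along \<open>k\<close> and
  \<open>- k\<close>; terms with \<open>k = 0\<close> are thereby counted twice, as in
  \<open>eisenstein_row_sums\<close>.\<close>

definition pair_term :: "complex \<Rightarrow> nat \<Rightarrow> nat \<Rightarrow> nat \<Rightarrow> complex" where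
  "pair_term t m n k = 1 / (of_nat (Suc n) * t + of_nat k) ^ m + 1 / (of_nat (Suc n) * t - of_nat k) ^ m"

text \<open>The value of column \<open>k\<close>. At \<open>k = 0\<close> the doubled terms give
  twice a zeta value; for \<open>k > 0\<close> they form a full row at \<open>k / t\<close> over
  \<open>t ^ m\<close>, except that the multiple 0 of \<open>t\<close> is absent, which removes
  \<open>1 / k ^ m\<close>.\<close>

definition pair_column :: "complex \<Rightarrow> nat \<Rightarrow> nat \<Rightarrow> complex" where
  "pair_column t m k = (if k = 0 then 2 * zeta_even m / t ^ m
                        else eisenstein_row m (of_nat k / t) / t ^ m - 1 / of_nat k ^ m)"

lemma pair_term_row_sums:
  assumes "Im t > 0" and m: "m = 2 \<or> m = 4"
  shows "pair_term t m n sums (eisenstein_row m (of_nat (Suc n) * t) + 1 / (of_nat (Suc n) * t) ^ m)"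
  unfolding pair_term_def
  by (rule eisenstein_row_sums[OF not_Ints_if_Im m]) (use assms in auto)

lemma zeta_even_scaled_sums:
  assumes "m = 2 \<or> m = 4"
  shows "(\<lambda>n. 1 / (of_nat (Suc n) * t) ^ m) sums (zeta_even m / t ^ m)"
  using sums_divide[OF zeta_even_sums[OF assms], of "t ^ m"]
  by (simp add: power_mult_distrib)

text \<open>Factoring \<open>t\<close> out of (n + 1) t + k leaves k / t + (n + 1), so a column is
  essentially a row at \<open>k / t\<close>.\<close>

lemma pair_term_column_sums:
  assumes t: "Im t > 0" and m: "m = 2 \<or> m = 4"
  shows "(\<lambda>n. pair_term t m n k) sums pair_column t m k"
proof (cases "k = 0")
  case True
  have "(\<lambda>n. 2 * (1 / (of_nat (Suc n) * t) ^ m)) sums (2 * (zeta_even m / t ^ m))"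
    by (rule sums_mult[OF zeta_even_scaled_sums[OF m]])
  then show ?thesis using True by (simp add: pair_term_def pair_column_def)
next
  case False
  define z where "z = of_nat k / t"
  have t0: "t \<noteq> 0" using t by auto
  have z0: "z \<noteq> 0" using False t0 by (simp add: z_def)
  have "Im z = - (of_nat k * Im t / (Re t ^ 2 + Im t ^ 2))"
    by (simp add: z_def Im_divide)
  then have "Im z \<noteq> 0" using t False by (auto simp: sum_power2_eq_zero_iff)
  then have "z \<notin> \<int>" by (rule not_Ints_if_Im)
  \<comment> \<open>Shifting the index drops the doubled term at 0, so the surplus
    \<open>1 / z ^ m\<close> becomes a deficit of the same size.\<close>
  from eisenstein_row_sums[OF this m]
  have "(\<lambda>n. 1 / (z + of_nat (Suc n)) ^ m + 1 / (z - of_nat (Suc n)) ^ m) sums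
          (eisenstein_row m z + 1 / z ^ m - (1 / (z + of_nat 0) ^ m + 1 / (z - of_nat 0) ^ m))"
    by (subst sums_Suc_iff) (simp add: add.commute)
  then have "(\<lambda>n. (1 / (z + of_nat (Suc n)) ^ m + 1 / (z - of_nat (Suc n)) ^ m) / t ^ m) sums
          ((eisenstein_row m z - 1 / z ^ m) / t ^ m)"
    by (intro sums_divide) simp
  moreover have "(1 / (z + of_nat (Suc n)) ^ m + 1 / (z - of_nat (Suc n)) ^ m) / t ^ m = pair_term t m n k" for n
  proof -
    have "(z + of_nat (Suc n)) * t = of_nat (Suc n) * t + of_nat k"
         "(z - of_nat (Suc n)) * t = - (of_nat (Suc n) * t - of_nat k)"
      using t0 by (simp_all add: z_def field_simps)
    moreover have "(- (of_nat (Suc n) * t - of_nat k)) ^ m = (of_nat (Suc n) * t - of_nat k) ^ m"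
      using m by (subst power_minus_even) auto
    ultimately have "(z + of_nat (Suc n)) ^ m * t ^ m = (of_nat (Suc n) * t + of_nat k) ^ m"
         "(z - of_nat (Suc n)) ^ m * t ^ m = (of_nat (Suc n) * t - of_nat k) ^ m"
      by (metis power_mult_distrib)+
    then show ?thesis by (simp add: pair_term_def add_divide_distrib)
  qed
  moreover have "(eisenstein_row m z - 1 / z ^ m) / t ^ m = pair_column t m k"
    using False t0 by (simp add: pair_column_def z_def diff_divide_distrib power_divide)
  ultimately show ?thesis by simp
qed

text \<open>\<open>L\<close> is the defect of interchanging the two summations: zero for weight 4, but not for the
  conditionally convergent weight 2.\<close>

lemma lattice_sum_inversion:
  assumes m: "m = 2 \<or> m = 4"
    and rows: "(\<lambda>n. eisenstein_row m (of_nat (Suc n) * t) + 1 / (of_nat (Suc n) * t) ^ m) sums S"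
    and cols: "pair_column t m sums (S - L)"
  obtains R where "(\<lambda>k. eisenstein_row m (of_nat (Suc k) / t) / t ^ m) sums R"
    and "(\<lambda>n. eisenstein_row m (of_nat (Suc n) * t)) sums (R + zeta_even m / t ^ m - zeta_even m + L)"
proof
  \<comment> \<open>The column total without \<open>k = 0\<close>, with the zeta value restored that
    the other columns subtract term by term.\<close>
  define R where "R = S - L - 2 * zeta_even m / t ^ m + zeta_even m"
  have "(\<lambda>k. pair_column t m (Suc k)) sums (S - L - 2 * zeta_even m / t ^ m)"
    using cols by (subst sums_Suc_iff) (simp add: pair_column_def)
  from sums_add[OF this zeta_even_sums[OF m]]
  show "(\<lambda>k. eisenstein_row m (of_nat (Suc k) / t) / t ^ m) sums R"
    by (simp add: R_def pair_column_def)
  have R_eq: "R + zeta_even m / t ^ m - zeta_even m + L = S - zeta_even m / t ^ m"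
    by (simp add: R_def)
  show "(\<lambda>n. eisenstein_row m (of_nat (Suc n) * t)) sums (R + zeta_even m / t ^ m - zeta_even m + L)"
    using sums_diff[OF rows zeta_even_scaled_sums[OF m, of t]] unfolding R_eq by simp
qed

text \<open>Order -4 is absolutely summable, so rows and columns have the same total and the defect
  is 0.\<close>

lemma weight_four_inversion:
  assumes t: "Im t > 0"
  obtains R where "(\<lambda>k. eisenstein_row 4 (of_nat (Suc k) / t) / t ^ 4) sums R"
    and "(\<lambda>n. eisenstein_row 4 (of_nat (Suc n) * t)) sums (R + zeta_even 4 / t ^ 4 - zeta_even 4)"
proof -
  obtain c where c: "c > 0"
    "\<And>n k. norm (of_nat (Suc n) * t + of_nat k) \<ge> c * sqrt (Suc n) * sqrt (Suc k)"
    "\<And>n k. norm (of_nat (Suc n) * t - of_nat k) \<ge> c * sqrt (Suc n) * sqrt (Suc k)"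
    using lattice_distance_bound[OF t] by blast
  have inv: "norm (1 / v ^ 4) \<le> 1 / c ^ 4 * inv_sqrt_cubed n * inv_sqrt_cubed k"
    if "norm v \<ge> c * sqrt (Suc n) * sqrt (Suc k)" for v :: complex and n k
  proof -
    define s where "s = sqrt (Suc n) * sqrt (Suc k)"
    \<comment> \<open>Because of this the fourth power can be lowered to the third, and the majorant
      for order -3 serves weight 4 as well.\<close>
    have s: "s \<ge> 1" unfolding s_def using mult_mono[of 1 "sqrt (Suc n)" 1 "sqrt (Suc k)"] by simp
    have "c ^ 4 * s ^ 3 \<le> c ^ 4 * s ^ 4"
      using s c(1) by (intro mult_left_mono power_increasing) auto
    also have "\<dots> \<le> norm v ^ 4"
      using that s c(1) by (subst power_mult_distrib[symmetric], intro power_mono) (auto simp: s_def mult.assoc)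
    finally have "1 / norm v ^ 4 \<le> 1 / (c ^ 4 * s ^ 3)"
      using s c(1) by (intro divide_left_mono) (auto intro!: mult_pos_pos elim: order.strict_trans2[rotated])
    then show ?thesis
      by (simp add: norm_divide norm_power inv_sqrt_cubed_def s_def power_mult_distrib mult.assoc)
  qed
  have bound: "norm (pair_term t 4 n k) \<le> 2 / c ^ 4 * inv_sqrt_cubed n * inv_sqrt_cubed k" for n k
    unfolding pair_term_def
    using norm_triangle_mono[OF inv[OF c(2)[of n k]] inv[OF c(3)[of n k]]] by (simp add: mult_ac)
  obtain S where S: "(\<lambda>n. eisenstein_row 4 (of_nat (Suc n) * t) + 1 / (of_nat (Suc n) * t) ^ 4) sums S"
    "pair_column t 4 sums S"
    by (rule suminf_swap_product_majorant[OF bound summable_inv_sqrt_cubed inv_sqrt_cubed_nonneg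
          pair_term_row_sums[OF t] pair_term_column_sums[OF t]]) auto
  from S(2) have "pair_column t 4 sums (S - 0)" by simp
  from lattice_sum_inversion[OF _ S(1) this] that show ?thesis by auto
qed

text \<open>In the difference of the digamma series at \<open>1 - z\<close> and \<open>1 + z\<close>
  the harmonic parts and Euler's constant cancel, leaving the Mittag-Leffler expansion. It evaluates
  the columns of the comparison family in weight 2.\<close>

lemma cot_sums:
  fixes z :: complex
  assumes z: "z \<notin> \<int>"
  shows "(\<lambda>n. 1 / (z + of_nat (Suc n)) + 1 / (z - of_nat (Suc n))) sums (pi * cot (pi * z) - 1 / z)"
proof -
  have nz: "z \<noteq> 0" "1 + z \<noteq> 0" "1 - z \<noteq> 0"
    using z by (auto simp: add_eq_0_iff)
  have *: "(\<lambda>n. inverse (of_nat (Suc n)) - inverse (w + of_nat n)) sums (Digamma w + euler_mascheroni)"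
    if "w \<noteq> 0" for w :: complex
    using summable_sums[OF summable_Digamma[OF that]] by (simp add: Digamma_def)
  have "(\<lambda>n. inverse (of_nat (Suc n)) - inverse (1 - z + of_nat n) -
             (inverse (of_nat (Suc n)) - inverse (1 + z + of_nat n))) sums
          (Digamma (1 - z) + euler_mascheroni - (Digamma (1 + z) + euler_mascheroni))"
    by (intro sums_diff *) (use nz in auto)
  also have "Digamma (1 - z) + euler_mascheroni - (Digamma (1 + z) + euler_mascheroni) =
               pi * cot (pi * z) - 1 / z"
    using Digamma_reflection[OF z] Digamma_plus1[OF nz(1)] by (simp add: add.commute algebra_simps)
  also have "(\<lambda>n. inverse (of_nat (Suc n)) - inverse (1 - z + of_nat n) -
             (inverse (of_nat (Suc n)) - inverse (1 + z + of_nat n))) =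
             (\<lambda>n. 1 / (z + of_nat (Suc n)) + 1 / (z - of_nat (Suc n)))"
  proof
    fix n
    have "1 - z + of_nat n = - (z - of_nat (Suc n))" "1 + z + of_nat n = z + of_nat (Suc n)"
      by simp_all
    then have "inverse (1 - z + of_nat n) = - (1 / (z - of_nat (Suc n)))"
      "inverse (1 + z + of_nat n) = 1 / (z + of_nat (Suc n))"
      by (simp_all only: inverse_minus_eq flip: inverse_eq_divide)
    moreover have "a - - b - (a - c) = c + b" for a b c :: complex
      by simp
    ultimately show "inverse (of_nat (Suc n)) - inverse (1 - z + of_nat n) -
             (inverse (of_nat (Suc n)) - inverse (1 + z + of_nat n)) =
             1 / (z + of_nat (Suc n)) + 1 / (z - of_nat (Suc n))"
      by (simp only:)
  qed
  finally show ?thesis .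
qed

text \<open>With \<open>q = exp (- 2 * \<i> * w)\<close>, the cotangent of K w is i (1 + q^K) / (1 -
  q^K), and |q| < 1 below the real axis.\<close>

lemma cot_lower_half_plane_limit:
  assumes "Im w < 0"
  shows "(\<lambda>K. cot (of_nat K * w)) \<longlonglongrightarrow> \<i>"
proof -
  define q where "q = exp (- 2 * \<i> * w)"
  have "norm q < 1" using assms by (simp add: q_def norm_exp_eq_Re)
  then have "(\<lambda>K. q ^ K) \<longlonglongrightarrow> 0" by (rule LIMSEQ_power_zero)
  then have "(\<lambda>K. \<i> * (1 + q ^ K) / (1 - q ^ K)) \<longlonglongrightarrow> \<i> * (1 + 0) / (1 - 0)"
    by (intro tendsto_divide tendsto_mult tendsto_add tendsto_diff tendsto_const) auto
  moreover have "cot (of_nat K * w) = \<i> * (1 + q ^ K) / (1 - q ^ K)" for K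
  proof -
    define v where "v = of_nat K * w"
    define e where "e = exp (\<i> * v)"
    have e: "e \<noteq> 0" by (simp add: e_def)
    have q: "q ^ K = 1 / e ^ 2"
    proof -
      have "q ^ K = exp (- (2 * (\<i> * v)))"
        unfolding q_def v_def exp_of_nat_mult[symmetric] by (rule arg_cong[of _ _ exp]) simp
      also have "\<dots> = 1 / e ^ 2"
        unfolding e_def exp_double[symmetric] exp_minus inverse_eq_divide ..
      finally show ?thesis .
    qed
    have "cot v = \<i> * (e + 1 / e) / (e - 1 / e)"
    proof -
      \<comment> \<open>The case \<open>B = 0\<close> occurs at \<open>K = 0\<close>, where both
        sides are 0 by the convention for division by zero.\<close>
      have "(A / 2) / (B / (2 * \<i>)) = \<i> * A / B" for A B :: complex
        by (cases "B = 0") (simp_all add: field_simps)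
      then show ?thesis
        by (simp only: cot_def cos_exp_eq sin_exp_eq e_def exp_minus inverse_eq_divide)
    qed
    also have "\<dots> = \<i> * (1 + 1 / e ^ 2) / (1 - 1 / e ^ 2)"
    proof -
      have "e + 1 / e = e * (1 + 1 / e ^ 2)" "e - 1 / e = e * (1 - 1 / e ^ 2)"
        using e by (simp_all add: distrib_left right_diff_distrib power2_eq_square)
      then show ?thesis using e by (simp only: mult.left_commute[of \<i> e] nonzero_mult_divide_mult_cancel_left[OF e])
    qed
    finally show ?thesis by (simp add: q v_def)
  qed
  ultimately show ?thesis by simp
qed

text \<open>The classical device for the quasimodular series E_2. The telescoping part that is
  subtracted contributes 0 by rows and \<open>- (pi * \<i> / t)\<close> by columns, so the defect of
  the interchange is \<open>pi * \<i> / t\<close>.\<close>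

lemma weight_two_inversion:
  assumes t: "Im t > 0"
  obtains R where "(\<lambda>k. eisenstein_row 2 (of_nat (Suc k) / t) / t ^ 2) sums R"
    and "(\<lambda>n. eisenstein_row 2 (of_nat (Suc n) * t)) sums (R + zeta_even 2 / t ^ 2 - zeta_even 2 + pi * \<i> / t)"
proof -
  have t0: "t \<noteq> 0" using t by auto
  \<comment> \<open>With x = (n + 1) t + k and y = (n + 1) t - k, the difference
    \<open>u n k - u n (Suc k)\<close> is 1 / (x (x + 1)) + 1 / (y (y - 1)), which matches
    \<open>pair_term t 2 n k\<close> to leading order.\<close>
  define u where "u n k = 1 / (of_nat (Suc n) * t + of_nat k) - 1 / (of_nat (Suc n) * t - of_nat k)" for n k :: nat
  define C where "C k = (if k = 0 then 0 else pi / t * cot (of_nat k * (pi / t)) - 1 / of_nat k)" for k :: nat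
  have nz: "of_nat (Suc n) * t + of_nat k \<noteq> 0" "of_nat (Suc n) * t - of_nat k \<noteq> 0" for n k
    using t by (auto simp: complex_eq_iff)
  have im: "Im (1 / t) < 0" using t by (simp add: Im_divide divide_neg_pos sum_power2_gt_zero_iff)
  have u_row: "(\<lambda>k. u n k - u n (Suc k)) sums 0" for n
  proof -
    let ?a = "of_nat (Suc n) * t"
    have "filterlim (\<lambda>k. v + of_nat k :: complex) at_infinity sequentially" for v
      by (rule tendsto_add_filterlim_at_infinity[OF tendsto_const tendsto_of_nat])
    from tendsto_divide_0[OF tendsto_const[of 1] this]
    have "(\<lambda>k. 1 / (?a + of_nat k) + 1 / (- ?a + of_nat k)) \<longlonglongrightarrow> 0 + 0"
      by (intro tendsto_add)
    moreover have "1 / (- ?a + of_nat k) = - (1 / (?a - of_nat k))" for k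
      by (metis minus_diff_eq minus_divide_right uminus_add_conv_diff)
    ultimately have "u n \<longlonglongrightarrow> 0" by (simp add: u_def[abs_def])
    from telescope_sums'[OF this] show ?thesis by (simp add: u_def)
  qed
  have u_col: "(\<lambda>n. u n k) sums C k" for k
  proof (cases "k = 0")
    case True
    then show ?thesis by (simp add: u_def C_def)
  next
    case False
    define z where "z = of_nat k / t"
    have "Im z \<noteq> 0" using False t by (auto simp: z_def Im_divide)
    then have "z \<notin> \<int>" by (rule not_Ints_if_Im)
    from sums_divide[OF cot_sums[OF this], of t]
    have "(\<lambda>n. (1 / (z + of_nat (Suc n)) + 1 / (z - of_nat (Suc n))) / t) sums C k"
      using False t0 by (simp add: C_def z_def diff_divide_distrib mult_ac)
    moreover have "(1 / (z + of_nat (Suc n)) + 1 / (z - of_nat (Suc n))) / t = u n k" for n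
    proof -
      have "(z + of_nat (Suc n)) * t = of_nat (Suc n) * t + of_nat k"
           "(z - of_nat (Suc n)) * t = - (of_nat (Suc n) * t - of_nat k)"
        using t0 by (simp_all add: z_def field_simps)
      then show ?thesis
        unfolding add_divide_distrib divide_divide_eq_left u_def
        by (simp only: minus_divide_right[symmetric]) simp
    qed
    ultimately show ?thesis by simp
  qed
  \<comment> \<open>\<open>C 0\<close> is 0, so the sum is minus the limit of \<open>C\<close>;
    since \<open>1 / t\<close> lies in the lower half-plane, the cotangent tends to
    \<open>\<i>\<close>.\<close>
  have C_sums: "(\<lambda>k. C k - C (Suc k)) sums (- (pi * \<i> / t))"
  proof -
    have "(\<lambda>k. cot (of_nat k * (pi / t))) \<longlonglongrightarrow> \<i>"
      using mult_pos_neg[OF pi_gt_zero im] by (intro cot_lower_half_plane_limit) (simp add: Im_divide)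
    then have "(\<lambda>k. pi / t * cot (of_nat k * (pi / t)) - 1 / of_nat k) \<longlonglongrightarrow> pi / t * \<i> - 0"
      by (intro tendsto_intros lim_1_over_n)
    moreover have "eventually (\<lambda>k. pi / t * cot (of_nat k * (pi / t)) - 1 / of_nat k = C k) sequentially"
      using eventually_gt_at_top[of 0] by eventually_elim (simp add: C_def)
    ultimately have "C \<longlonglongrightarrow> pi / t * \<i>" by (simp add: tendsto_cong)
    from telescope_sums'[OF this] show ?thesis by (simp add: C_def)
  qed
  obtain c where c: "c > 0"
    "\<And>n k. norm (of_nat (Suc n) * t + of_nat k) \<ge> c * sqrt (Suc n) * sqrt (Suc k)"
    "\<And>n k. norm (of_nat (Suc n) * t - of_nat k) \<ge> c * sqrt (Suc n) * sqrt (Suc k)"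
    using lattice_distance_bound[OF t] by blast
  have inv: "norm (1 / (v ^ 2 * w)) \<le> 1 / c ^ 3 * inv_sqrt_cubed n * inv_sqrt_cubed k"
    if v: "norm v \<ge> c * sqrt (Suc n) * sqrt (Suc k)"
      and w: "norm w \<ge> c * sqrt (Suc n) * sqrt (Suc (Suc k))" for v w :: complex and n k
  proof -
    define s where "s = sqrt (Suc n) * sqrt (Suc k)"
    have s: "s > 0" by (simp add: s_def)
    have "c * sqrt (Suc n) * sqrt (Suc k) \<le> c * sqrt (Suc n) * sqrt (Suc (Suc k))"
      using c(1) by (intro mult_left_mono) auto
    with w v have vw: "c * s \<le> norm w" "c * s \<le> norm v" by (simp_all add: s_def mult.assoc)
    have "(c * s) ^ 2 * (c * s) \<le> norm v ^ 2 * norm w"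
      using vw s c(1) by (intro mult_mono power_mono) auto
    moreover have "(c * s) ^ 2 * (c * s) = c ^ 3 * s ^ 3" by (simp add: power_numeral_reduce)
    moreover have "norm v ^ 2 * norm w > 0"
      using vw s c(1) by (metis mult_pos_pos less_le_trans zero_less_power)
    ultimately have "1 / (norm v ^ 2 * norm w) \<le> 1 / (c ^ 3 * s ^ 3)"
      using s c(1) by (intro divide_left_mono) auto
    then show ?thesis
      by (simp add: norm_divide norm_power norm_mult inv_sqrt_cubed_def s_def power_mult_distrib mult.assoc)
  qed
  (* Subtracting a term that telescopes in k leaves a family of order -3, which is summable. *)
  define f where "f n k = pair_term t 2 n k - (u n k - u n (Suc k))" for n k
  have f_eq: "f n k =
      1 / ((of_nat (Suc n) * t + of_nat k) ^ 2 * (of_nat (Suc n) * t + of_nat (Suc k))) -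
      1 / ((of_nat (Suc n) * t - of_nat k) ^ 2 * (of_nat (Suc n) * t - of_nat (Suc k)))" for n k
  proof -
    define a where "a = of_nat (Suc n) * t"
    define x where "x = a + of_nat k"
    define y where "y = a - of_nat k"
    have shift: "a + of_nat (Suc k) = x + 1" "a - of_nat (Suc k) = y - 1" by (simp_all add: x_def y_def)
    have xy: "x \<noteq> 0" "y \<noteq> 0" "x + 1 \<noteq> 0" "y - 1 \<noteq> 0"
      using nz[of n k] nz[of n "Suc k"] unfolding a_def[symmetric] shift by (simp_all add: x_def y_def)
    have "1 / (x ^ 2 * (x + 1)) = 1 / x ^ 2 - 1 / x + 1 / (x + 1)"
      "1 / (y ^ 2 * (y - 1)) = 1 / (y - 1) - 1 / y ^ 2 - 1 / y"
      using xy by (simp_all add: divide_simps) (simp_all add: algebra_simps power2_eq_square)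
    then show ?thesis
      unfolding f_def pair_term_def u_def a_def[symmetric] shift x_def[symmetric] y_def[symmetric]
      by simp
  qed
  have bound: "norm (f n k) \<le> 2 / c ^ 3 * inv_sqrt_cubed n * inv_sqrt_cubed k" for n k
    unfolding f_eq
    using norm_triangle_mono[OF inv[OF c(2)[of n k] c(2)[of n "Suc k"]]
       order_trans[OF eq_refl[OF norm_minus_cancel] inv[OF c(3)[of n k] c(3)[of n "Suc k"]]]] by (simp add: mult_ac)
  have row: "f n sums (eisenstein_row 2 (of_nat (Suc n) * t) + 1 / (of_nat (Suc n) * t) ^ 2)" for n
  proof -
    have "(\<lambda>k. pair_term t 2 n k - (u n k - u n (Suc k))) sums
            (eisenstein_row 2 (of_nat (Suc n) * t) + 1 / (of_nat (Suc n) * t) ^ 2 - 0)"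
      by (intro sums_diff pair_term_row_sums t u_row) simp
    then show ?thesis by (simp only: f_def[abs_def] diff_0_right)
  qed
  have col: "(\<lambda>n. f n k) sums (pair_column t 2 k - (C k - C (Suc k)))" for k
    unfolding f_def by (intro sums_diff pair_term_column_sums t u_col) simp
  obtain S where S: "(\<lambda>n. eisenstein_row 2 (of_nat (Suc n) * t) + 1 / (of_nat (Suc n) * t) ^ 2) sums S"
    "(\<lambda>k. pair_column t 2 k - (C k - C (Suc k))) sums S"
    using suminf_swap_product_majorant[OF bound summable_inv_sqrt_cubed inv_sqrt_cubed_nonneg row col] by blast
  from sums_add[OF S(2) C_sums] have cols: "pair_column t 2 sums (S - pi * \<i> / t)"
    by (simp only: diff_add_cancel add_uminus_conv_diff)
  obtain R where "(\<lambda>k. eisenstein_row 2 (of_nat (Suc k) / t) / t ^ 2) sums R"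
    "(\<lambda>n. eisenstein_row 2 (of_nat (Suc n) * t)) sums (R + zeta_even 2 / t ^ 2 - zeta_even 2 + pi * \<i> / t)"
    using lattice_sum_inversion[OF disjI1[OF refl] S(1) cols] by blast
  then show ?thesis by (rule that)
qed

section \<open>Inversion of the hyperbolic sums\<close>

definition csch_sum :: "nat \<Rightarrow> complex \<Rightarrow> complex" where
  "csch_sum j \<phi> = (\<Sum>n. 1 / sinh (of_nat (Suc n) * \<phi> / 2) ^ j)"

text \<open>Two terms of the exponential series give \<open>x ^ M / fact M \<le> exp x - 1\<close>,
  and |sinh w| is at least half of \<open>exp x - exp (- x)\<close>. Flatness asks only for
  arbitrary powers, so these bounds stand in for exponential decay.\<close>

lemma norm_sinh_ge_power:
  fixes w :: complex
  assumes "Re w > 0" "M > 0"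
  shows "norm (sinh w) \<ge> Re w ^ M / (2 * fact M)"
proof -
  define x where "x = Re w"
  have x: "x > 0" using assms by (simp add: x_def)
  have "(\<Sum>n\<in>{0, M}. x ^ n /\<^sub>R fact n) \<le> exp x"
    unfolding exp_def by (rule sum_le_suminf[OF summable_exp_generic]) (use x in auto)
  then have "x ^ M / fact M \<le> exp x - 1"
    using assms(2) by (simp add: field_simps)
  also have "\<dots> \<le> exp x - exp (- x)" using x by simp
  also have "\<dots> = norm (exp w) - norm (exp (- w))" by (simp add: x_def)
  also have "\<dots> \<le> norm (exp w - exp (- w))" by (rule norm_triangle_ineq2)
  also have "\<dots> = 2 * norm (sinh w)" by (simp add: sinh_def norm_divide)
  finally show ?thesis by (simp add: x_def field_simps)
qed

text \<open>The full power of \<open>Re \<psi>\<close> is kept for the decay, while the same power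
  of n + 1 is weakened to a square, so that summing over \<open>n\<close> gives zeta(2). The factor
  \<open>2 ^ M\<close> undoes the halved argument of sinh.\<close>

lemma norm_csch_power_le:
  assumes "Re \<psi> > 0" "M \<ge> 2" "j \<ge> 1"
  shows "norm (1 / sinh (of_nat (Suc n) * \<psi> / 2) ^ j) \<le>
           (2 * fact M * 2 ^ M) ^ j / Re \<psi> ^ (M * j) * (1 / real (n + 1) ^ 2)"
proof -
  define x where "x = Re \<psi>"
  define y where "y = real (Suc n)"
  have x: "x > 0" and y: "y \<ge> 1" using assms by (simp_all add: x_def y_def)
  have "Re (of_nat (Suc n) * \<psi> / 2) = y * x / 2" by (simp add: x_def y_def)
  then have "norm (sinh (of_nat (Suc n) * \<psi> / 2)) \<ge> (y * x / 2) ^ M / (2 * fact M)"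
    using norm_sinh_ge_power[of "of_nat (Suc n) * \<psi> / 2" M] x y assms(2) by simp
  then have "((y * x / 2) ^ M / (2 * fact M)) ^ j \<le> norm (sinh (of_nat (Suc n) * \<psi> / 2)) ^ j"
    using x y by (intro power_mono) auto
  then have "norm (1 / sinh (of_nat (Suc n) * \<psi> / 2) ^ j) \<le> 1 / ((y * x / 2) ^ M / (2 * fact M)) ^ j"
    unfolding norm_divide norm_power using x y by (simp add: frac_le)
  also have "\<dots> = (2 * fact M * 2 ^ M) ^ j / x ^ (M * j) * (1 / y ^ (M * j))"
    using x y by (simp add: field_simps power_mult)
  also have "\<dots> \<le> (2 * fact M * 2 ^ M) ^ j / x ^ (M * j) * (1 / y ^ 2)"
  proof (intro mult_left_mono divide_left_mono power_increasing)
    show "2 \<le> M * j" using assms(2,3) mult_le_mono[of 2 M 1 j] by simp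
  qed (use x y in auto)
  finally show ?thesis by (simp add: x_def y_def add.commute)
qed

lemma real_inverse_squares_sums: "(\<lambda>n. 1 / real (n + 1) ^ 2) sums (pi\<^sup>2 / 6)"
  using inverse_squares_sums by simp

lemma summable_csch_power:
  assumes "Re \<phi> > 0" "j \<ge> 1"
  shows "summable (\<lambda>n. 1 / sinh (of_nat (Suc n) * \<phi> / 2) ^ j)"
proof (rule summable_comparison_test')
  show "norm (1 / sinh (of_nat (Suc n) * \<phi> / 2) ^ j) \<le>
          (2 * fact 2 * 2 ^ 2) ^ j / Re \<phi> ^ (2 * j) * (1 / real (n + 1) ^ 2)" for n
    by (rule norm_csch_power_le) (use assms in auto)
qed (intro summable_mult sums_summable[OF real_inverse_squares_sums])

lemma csch_sums:
  assumes "Re \<phi> > 0" "j \<ge> 1"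
  shows "(\<lambda>n. 1 / sinh (of_nat (Suc n) * \<phi> / 2) ^ j) sums csch_sum j \<phi>"
  unfolding csch_sum_def by (intro summable_sums summable_csch_power assms)

lemma norm_csch_sum_le:
  assumes "Re \<psi> > 0" "M \<ge> 2" "j \<ge> 1"
  shows "norm (csch_sum j \<psi>) \<le> (2 * fact M * 2 ^ M) ^ j * (pi\<^sup>2 / 6) / Re \<psi> ^ (M * j)"
proof -
  have "norm (csch_sum j \<psi>) \<le>
          (\<Sum>n. (2 * fact M * 2 ^ M) ^ j / Re \<psi> ^ (M * j) * (1 / real (n + 1) ^ 2))"
    unfolding csch_sum_def
    by (intro norm_suminf_le norm_csch_power_le assms summable_mult sums_summable[OF real_inverse_squares_sums])
  also have "\<dots> = (2 * fact M * 2 ^ M) ^ j / Re \<psi> ^ (M * j) * (pi\<^sup>2 / 6)"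
    by (rule sums_unique[symmetric, OF sums_mult[OF real_inverse_squares_sums]])
  finally show ?thesis by simp
qed

lemma sin_i_times: "sin (\<i> * w) = \<i> * sinh w"
  by (simp add: sin_conv_sinh)

text \<open>Only even powers of sin (i w) = i sinh w occur, so the sign of the argument does not
  matter; multiples of \<open>t\<close> produce one sign and multiples of \<open>1 / t\<close> the
  other.\<close>

lemma eisenstein_row_i_times:
  assumes "of_real pi * z = \<i> * w \<or> of_real pi * z = - (\<i> * w)"
  shows "eisenstein_row 2 z = - (of_real pi ^ 2) * (1 / sinh w ^ 2)"
    and "eisenstein_row 4 z = of_real pi ^ 4 * (1 / sinh w ^ 4 + 2 / 3 * (1 / sinh w ^ 2))"
proof -
  have "sin (of_real pi * z) ^ 2 = - (sinh w ^ 2)"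
    using assms by (auto simp: sin_i_times power_mult_distrib)
  moreover from this have "sin (of_real pi * z) ^ 4 = sinh w ^ 4"
    using power_mult[of "sin (of_real pi * z)" 2 2] power_mult[of "sinh w" 2 2] by simp
  ultimately show "eisenstein_row 2 z = - (of_real pi ^ 2) * (1 / sinh w ^ 2)"
    "eisenstein_row 4 z = of_real pi ^ 4 * (1 / sinh w ^ 4 + 2 / 3 * (1 / sinh w ^ 2))"
    by (simp_all add: eisenstein_row_def)
qed

lemma eisenstein_row_csch_sums:
  assumes "Re w > 0"
    and "\<And>n. of_real pi * z n = \<i> * (of_nat (Suc n) * w / 2) \<or>
                of_real pi * z n = - (\<i> * (of_nat (Suc n) * w / 2))"
  shows "(\<lambda>n. eisenstein_row 2 (z n)) sums (- (of_real pi ^ 2) * csch_sum 2 w)"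
    and "(\<lambda>n. eisenstein_row 4 (z n)) sums (of_real pi ^ 4 * (csch_sum 4 w + 2 / 3 * csch_sum 2 w))"
  unfolding eisenstein_row_i_times[OF assms(2)]
  by (intro sums_mult sums_add csch_sums assms(1); simp)+

context
  fixes \<phi> t \<psi> :: complex
  assumes \<phi>: "Re \<phi> > 0"
  defines "t \<equiv> \<i> * \<phi> / (2 * pi)" and "\<psi> \<equiv> 4 * pi\<^sup>2 / \<phi>"
begin

lemma Im_t_pos: "Im t > 0"
  using \<phi> by (simp add: t_def Im_divide power2_eq_square)

lemma Re_dual_pos: "Re \<psi> > 0"
  using \<phi> by (simp add: \<psi>_def Re_divide sum_power2_gt_zero_iff)

lemma pi_times_lattice:
  "of_real pi * (of_nat n * t) = \<i> * (of_nat n * \<phi> / 2)"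
  "of_real pi * (of_nat n / t) = - (\<i> * (of_nat n * \<psi> / 2))"
proof -
  have "\<phi> \<noteq> 0" using \<phi> by auto
  then have "of_nat n / t = - (\<i> * (of_nat n * (2 * pi / \<phi>)))"
    by (subst divide_eq_eq) (simp add: t_def mult.left_commute[of \<i>])
  then show "of_real pi * (of_nat n / t) = - (\<i> * (of_nat n * \<psi> / 2))"
    by (simp add: \<psi>_def power2_eq_square mult_ac)
qed (simp add: t_def)

lemma eisenstein_row_lattice_sums:
  "(\<lambda>n. eisenstein_row 2 (of_nat (Suc n) * t)) sums (- (of_real pi ^ 2) * csch_sum 2 \<phi>)"
  "(\<lambda>n. eisenstein_row 2 (of_nat (Suc n) / t)) sums (- (of_real pi ^ 2) * csch_sum 2 \<psi>)"
  "(\<lambda>n. eisenstein_row 4 (of_nat (Suc n) * t)) sums (of_real pi ^ 4 * (csch_sum 4 \<phi> + 2 / 3 * csch_sum 2 \<phi>))"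
  "(\<lambda>n. eisenstein_row 4 (of_nat (Suc n) / t)) sums (of_real pi ^ 4 * (csch_sum 4 \<psi> + 2 / 3 * csch_sum 2 \<psi>))"
  by (rule eisenstein_row_csch_sums[OF \<phi>] eisenstein_row_csch_sums[OF Re_dual_pos], use pi_times_lattice in blast)+

text \<open>This is the weight 2 inversion multiplied by - \<phi>^2 / pi^2: zeta(2) contributes
  \<open>2 * pi\<^sup>2 / 3\<close> and \<open>\<phi> ^ 2 / 6\<close>, the defect contributes
  \<open>- 2 * \<phi>\<close>.\<close>

lemma csch_sum_2_inversion:
  "\<phi> ^ 2 * csch_sum 2 \<phi> = 2 * pi\<^sup>2 / 3 - 2 * \<phi> + \<phi> ^ 2 / 6 - 4 * pi\<^sup>2 * csch_sum 2 \<psi>"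
proof -
  have \<phi>0: "\<phi> \<noteq> 0" using \<phi> by auto
  obtain R where R: "(\<lambda>k. eisenstein_row 2 (of_nat (Suc k) / t) / t ^ 2) sums R"
    "(\<lambda>n. eisenstein_row 2 (of_nat (Suc n) * t)) sums (R + zeta_even 2 / t ^ 2 - zeta_even 2 + pi * \<i> / t)"
    using weight_two_inversion[OF Im_t_pos] by blast
  have "R = - (of_real pi ^ 2) * csch_sum 2 \<psi> / t ^ 2"
    using sums_unique2[OF R(1) sums_divide[OF eisenstein_row_lattice_sums(2)]] .
  with sums_unique2[OF eisenstein_row_lattice_sums(1) R(2)]
  have "- (of_real pi ^ 2) * csch_sum 2 \<phi> = - (of_real pi ^ 2) * csch_sum 2 \<psi> / t ^ 2 +
          zeta_even 2 / t ^ 2 - zeta_even 2 + pi * \<i> / t" by simp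
  also have "\<i> / t = 2 * pi / \<phi>" using \<phi>0 by (simp add: t_def)
  then have "pi * \<i> / t = 2 * pi ^ 2 / \<phi>" by (simp add: power2_eq_square flip: times_divide_eq_right)
  also have "t ^ 2 = - (\<phi> ^ 2 / (4 * pi ^ 2))"
    by (simp add: t_def power_mult_distrib power_divide)
  finally have "(3 * \<phi> * pi\<^sup>2) * (\<phi> ^ 2 * csch_sum 2 \<phi>) =
    (3 * \<phi> * pi\<^sup>2) * (2 * pi\<^sup>2 / 3 - 2 * \<phi> + \<phi> ^ 2 / 6 - 4 * pi\<^sup>2 * csch_sum 2 \<psi>)"
    using \<phi>0 by (simp add: zeta_even_def field_simps power_numeral_reduce)
  then show ?thesis
    using \<phi>0 by (subst (asm) mult_left_cancel) auto
qed

text \<open>Weight 4 determines only \<open>csch_sum 4 \<phi> + 2 / 3 * csch_sum 2 \<phi>\<close>.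
  Subtracting 2/3 \<phi>^2 times the weight 2 relation isolates the fourth powers; it brings in the
  odd term, and -1/90 - 1/9 is the coefficient -11/90.\<close>

lemma csch_sum_4_inversion:
  "\<phi> ^ 4 * csch_sum 4 \<phi> =
     8 * pi ^ 4 / 45 - 4 * pi\<^sup>2 / 9 * \<phi> ^ 2 + 4 / 3 * \<phi> ^ 3 - 11 / 90 * \<phi> ^ 4 +
     16 * pi ^ 4 * (csch_sum 4 \<psi> + 2 / 3 * csch_sum 2 \<psi>) + 8 * pi\<^sup>2 / 3 * \<phi> ^ 2 * csch_sum 2 \<psi>"
proof -
  have \<phi>0: "\<phi> \<noteq> 0" using \<phi> by auto
  obtain R where R: "(\<lambda>k. eisenstein_row 4 (of_nat (Suc k) / t) / t ^ 4) sums R"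
    "(\<lambda>n. eisenstein_row 4 (of_nat (Suc n) * t)) sums (R + zeta_even 4 / t ^ 4 - zeta_even 4)"
    using weight_four_inversion[OF Im_t_pos] by blast
  have "R = of_real pi ^ 4 * (csch_sum 4 \<psi> + 2 / 3 * csch_sum 2 \<psi>) / t ^ 4"
    using sums_unique2[OF R(1) sums_divide[OF eisenstein_row_lattice_sums(4)]] .
  with sums_unique2[OF eisenstein_row_lattice_sums(3) R(2)]
  have "of_real pi ^ 4 * (csch_sum 4 \<phi> + 2 / 3 * csch_sum 2 \<phi>) =
          of_real pi ^ 4 * (csch_sum 4 \<psi> + 2 / 3 * csch_sum 2 \<psi>) / t ^ 4 +
          of_real pi ^ 4 / 90 / t ^ 4 - of_real pi ^ 4 / 90" by (simp add: zeta_even_def)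
  also have "\<dots> = of_real pi ^ 4 *
      ((csch_sum 4 \<psi> + 2 / 3 * csch_sum 2 \<psi>) / t ^ 4 + 1 / 90 / t ^ 4 - 1 / 90)"
    by (simp add: algebra_simps)
  finally have "csch_sum 4 \<phi> + 2 / 3 * csch_sum 2 \<phi> =
      (csch_sum 4 \<psi> + 2 / 3 * csch_sum 2 \<psi>) / t ^ 4 + 1 / 90 / t ^ 4 - 1 / 90"
    by (subst (asm) mult_left_cancel) auto
  also have "t ^ 4 = \<phi> ^ 4 / (16 * pi ^ 4)"
    by (simp add: t_def power_mult_distrib power_divide)
  finally have inv: "\<phi> ^ 4 * (csch_sum 4 \<phi> + 2 / 3 * csch_sum 2 \<phi>) =
      16 * pi ^ 4 * (csch_sum 4 \<psi> + 2 / 3 * csch_sum 2 \<psi>) + 16 * pi ^ 4 / 90 - \<phi> ^ 4 / 90"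
    using \<phi>0 by (simp add: field_simps)
  have split: "\<phi> ^ 4 * csch_sum 4 \<phi> =
      \<phi> ^ 4 * (csch_sum 4 \<phi> + 2 / 3 * csch_sum 2 \<phi>) - 2 / 3 * \<phi> ^ 2 * (\<phi> ^ 2 * csch_sum 2 \<phi>)"
    by (simp add: algebra_simps power_numeral_reduce)
  show ?thesis
    unfolding split inv csch_sum_2_inversion by (simp add: algebra_simps power_numeral_reduce)
qed

end

section \<open>Flat remainders and distillates\<close>

lemma power_smallo_powi:
  fixes S :: "complex set"
  assumes "int M > N"
  shows "(\<lambda>z. z ^ M) \<in> o[at 0 within S](\<lambda>z. z powi N)"
proof (rule smalloI_tendsto)
  define k where "k = nat (int M - N)"
  have k: "k > 0" "int k = int M - N" using assms by (auto simp: k_def)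
  have "((\<lambda>z::complex. z ^ k) \<longlongrightarrow> 0 ^ k) (at 0 within S)"
    by (intro tendsto_intros)
  then have "((\<lambda>z::complex. z ^ k) \<longlongrightarrow> 0) (at 0 within S)"
    using k(1) by (simp only: zero_power)
  moreover have "\<forall>\<^sub>F z in at 0 within S. z ^ k = z ^ M / z powi N"
    unfolding eventually_at_filter
    by (intro always_eventually allI impI)
       (metis k(2) power_int_diff power_int_of_nat)
  ultimately show "((\<lambda>z. z ^ M / z powi N) \<longlongrightarrow> 0) (at 0 within S)"
    by (rule Lim_transform_eventually)
  show "\<forall>\<^sub>F z in at 0 within S. z powi N \<noteq> 0"
    unfolding eventually_at_filter by (intro always_eventually) auto
qed

text \<open>A flat function has zero asymptotic expansion at 0. All integers \<open>N\<close> occur,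
  matching the quantifier in \<open>has_asymptotic_series\<close>.\<close>

definition flat_on :: "complex set \<Rightarrow> (complex \<Rightarrow> complex) \<Rightarrow> bool" where
  "flat_on S r \<longleftrightarrow> (\<forall>N::int. r \<in> o[at 0 within S](\<lambda>z. z powi N))"

lemma flat_on_cong:
  assumes "flat_on S r" "\<And>z. z \<in> S \<Longrightarrow> z \<noteq> 0 \<Longrightarrow> r' z = r z"
  shows "flat_on S r'"
proof -
  have "\<forall>\<^sub>F z in at 0 within S. r' z = r z"
    using assms(2) by (simp add: eventually_at_filter)
  then show ?thesis
    using assms(1) landau_o.small.in_cong[of r' r] unfolding flat_on_def by blast
qed

lemma flat_on_add: "flat_on S r \<Longrightarrow> flat_on S s \<Longrightarrow> flat_on S (\<lambda>z. r z + s z)"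
  unfolding flat_on_def by (blast intro: sum_in_smallo)

lemma flat_on_cmult: "flat_on S r \<Longrightarrow> flat_on S (\<lambda>z. c * r z)"
  unfolding flat_on_def by (cases "c = 0") auto

lemma flat_on_power_mult:
  assumes "flat_on S r"
  shows "flat_on S (\<lambda>z. z ^ k * r z)"
  unfolding flat_on_def
proof
  fix N :: int
  have "((\<lambda>z::complex. z ^ k / 1) \<longlongrightarrow> 0 ^ k / 1) (at 0 within S)"
    by (intro tendsto_intros) auto
  then have "(\<lambda>z::complex. z ^ k) \<in> O[at 0 within S](\<lambda>_. 1)"
    by (rule bigoI_tendsto) auto
  moreover have "r \<in> o[at 0 within S](\<lambda>z. z powi N)"
    using assms by (simp add: flat_on_def)
  ultimately have "(\<lambda>z. z ^ k * r z) \<in> o[at 0 within S](\<lambda>z. 1 * z powi N)"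
    by (rule landau_o.big_small_mult)
  then show "(\<lambda>z. z ^ k * r z) \<in> o[at 0 within S](\<lambda>z. z powi N)" by simp
qed

text \<open>In the sector \<open>Re z \<ge> sin \<delta> * norm z\<close>, so the dual point has
  real part at least \<open>b / norm z\<close> and inverse powers of it become powers of
  \<open>norm z\<close>. The bound degenerates as \<delta> tends to 0: it holds on each proper
  subsector, with a constant depending on \<delta>.\<close>

lemma flat_on_csch_sum_dual:
  assumes \<delta>: "\<delta> \<in> {0<..<pi/2}" and j: "j \<ge> 1"
  shows "flat_on (right_sector \<delta>) (\<lambda>z. csch_sum j (4 * pi\<^sup>2 / z))"
  unfolding flat_on_def
proof
  fix N :: int
  \<comment> \<open>The 2 makes the sum over \<open>n\<close> converge; \<open>N + 1\<close> beats
    \<open>z powi N\<close>.\<close>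
  define M where "M = max 2 (nat (N + 1))"
  define b where "b = 4 * pi\<^sup>2 * sin \<delta>"
  have b: "b > 0" using \<delta> by (auto simp: b_def intro!: mult_pos_pos sin_gt_zero)
  define K where "K = (2 * fact M * 2 ^ M) ^ j * (pi\<^sup>2 / 6) / b ^ (M * j)"
  have bound: "norm (csch_sum j (4 * pi\<^sup>2 / z)) \<le> K * norm (z ^ (M * j))"
    if z: "z \<in> right_sector \<delta>" for z :: complex
  proof -
    have z0: "norm z > 0" using z by (simp add: right_sector_def)
    have "cos \<bar>Arg z\<bar> \<ge> cos (pi / 2 - \<delta>)"
      using z \<delta> by (intro cos_monotone_0_pi_le) (auto simp: right_sector_def)
    then have "cos (Arg z) \<ge> sin \<delta>" by (simp add: cos_diff)
    then have re: "Re z \<ge> sin \<delta> * norm z"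
      using z0 by (simp add: cos_Arg field_simps)
    have "b / norm z \<le> 4 * pi\<^sup>2 * Re z / norm z ^ 2"
      using re z0 by (simp add: b_def field_simps power2_eq_square)
    also have "\<dots> = Re (4 * pi\<^sup>2 / z)"
      by (simp add: Re_divide cmod_power2)
    finally have dual: "b / norm z \<le> Re (4 * pi\<^sup>2 / z)" .
    then have pos: "Re (4 * pi\<^sup>2 / z) > 0" using b z0 by (meson divide_pos_pos less_le_trans)
    have "norm (csch_sum j (4 * pi\<^sup>2 / z)) \<le>
            (2 * fact M * 2 ^ M) ^ j * (pi\<^sup>2 / 6) / Re (4 * pi\<^sup>2 / z) ^ (M * j)"
      by (rule norm_csch_sum_le[OF pos _ j]) (simp add: M_def)
    also have "\<dots> \<le> (2 * fact M * 2 ^ M) ^ j * (pi\<^sup>2 / 6) / (b / norm z) ^ (M * j)"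
      using b z0 pos by (intro divide_left_mono power_mono dual mult_pos_pos) auto
    also have "\<dots> = K * norm (z ^ (M * j))"
      by (simp add: K_def norm_power power_divide)
    finally show ?thesis .
  qed
  have "(\<lambda>z. csch_sum j (4 * pi\<^sup>2 / z)) \<in> O[at 0 within right_sector \<delta>](\<lambda>z. z ^ (M * j))"
    by (rule bigoI[where c = K]) (use bound in \<open>simp add: eventually_at_filter\<close>)
  moreover have "(\<lambda>z. z ^ (M * j)) \<in> o[at 0 within right_sector \<delta>](\<lambda>z. z powi N)"
  proof (rule power_smallo_powi)
    have "M * 1 \<le> M * j" using j by (intro mult_le_mono) auto
    then have "int M \<le> int (M * j)" by (simp only: of_nat_le_iff mult_1_right)
    moreover have "N < int M" by (auto simp: M_def)
    ultimately show "N < int (M * j)" by (rule less_le_trans[rotated])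
  qed
  ultimately show "(\<lambda>z. csch_sum j (4 * pi\<^sup>2 / z)) \<in> o[at 0 within right_sector \<delta>](\<lambda>z. z powi N)"
    by (rule landau_o.big_small_trans)
qed

text \<open>Up to index \<open>N\<close> the polynomial is the partial sum; its finitely many later
  terms and the flat remainder are of smaller order.\<close>

lemma poly_has_asymptotic_series:
  assumes lim: "0 islimpt S" and flat: "flat_on S (\<lambda>z. f z - poly P z)"
  shows "has_asymptotic_series f (fps_to_fls (fps_of_poly P)) 0 S"
  unfolding has_asymptotic_series_def
proof (intro conjI allI lim)
  fix N :: int
  let ?A = "fps_to_fls (fps_of_poly P)"
  define lo where "lo = {i. i \<le> degree P \<and> int i \<le> N}"
  define hi where "hi = {i. i \<le> degree P \<and> int i > N}"
  have partial: "(\<Sum>n\<in>{fls_subdegree ?A..N}. fls_nth ?A n * (z - 0) powi n) = (\<Sum>i\<in>lo. coeff P i * z ^ i)"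
    for z
  proof -
    have "(\<Sum>n\<in>{fls_subdegree ?A..N}. fls_nth ?A n * (z - 0) powi n) =
          (\<Sum>n\<in>int ` lo. fls_nth ?A n * (z - 0) powi n)"
    \<comment> \<open>The two index sets differ only where the coefficient is 0: below the
      subdegree, at negative indices, or above the degree of \<open>P\<close>.\<close>
    proof (rule sum.mono_neutral_cong)
      show "fls_nth ?A n * (z - 0) powi n = 0" if "n \<in> int ` lo - {fls_subdegree ?A..N}" for n
      proof -
        have "n < fls_subdegree ?A" using that by (auto simp: lo_def)
        then show ?thesis by (simp only: fls_eq0_below_subdegree mult_zero_left)
      qed
      show "fls_nth ?A n * (z - 0) powi n = 0" if "n \<in> {fls_subdegree ?A..N} - int ` lo" for n
      proof (cases "n < 0")
        case False
        then have "nat n \<notin> lo" using that by (metis DiffD2 image_eqI nat_0_le not_less)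
        then have "nat n > degree P" using that False by (auto simp: lo_def)
        then show ?thesis using False by (simp add: coeff_eq_0)
      qed simp
    qed (auto simp: lo_def)
    also have "\<dots> = (\<Sum>i\<in>lo. coeff P i * z ^ i)"
      by (subst sum.reindex) (auto simp: power_int_of_nat)
    finally show ?thesis .
  qed
  have "poly P z = (\<Sum>i\<in>lo \<union> hi. coeff P i * z ^ i)" for z
    unfolding poly_altdef by (rule sum.cong) (auto simp: lo_def hi_def)
  then have split: "poly P z = (\<Sum>i\<in>lo. coeff P i * z ^ i) + (\<Sum>i\<in>hi. coeff P i * z ^ i)" for z
    by (subst sum.union_disjoint[symmetric]) (auto simp: lo_def hi_def)
  have remainder: "f z - (\<Sum>i\<in>lo. coeff P i * z ^ i) =
      (f z - poly P z) + (\<Sum>i\<in>hi. coeff P i * z ^ i)" for z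
    by (simp add: split)
  have "(\<lambda>z. coeff P i * z ^ i) \<in> o[at 0 within S](\<lambda>z. z powi N)" if "i \<in> hi" for i
    using that power_smallo_powi[of N i S] by (cases "coeff P i = 0") (auto simp: hi_def)
  then have "(\<lambda>z. (\<Sum>i\<in>hi. coeff P i * z ^ i)) \<in> o[at 0 within S](\<lambda>z. z powi N)"
    by (rule big_sum_in_smallo)
  moreover have "(\<lambda>z. f z - poly P z) \<in> o[at 0 within S](\<lambda>z. z powi N)"
    using flat by (simp add: flat_on_def)
  ultimately have "(\<lambda>z. (f z - poly P z) + (\<Sum>i\<in>hi. coeff P i * z ^ i)) \<in> o[at 0 within S](\<lambda>z. z powi N)"
    by (intro sum_in_smallo(1)[of "\<lambda>z. f z - poly P z"])
  then show "(\<lambda>z. f z - (\<Sum>n\<in>{fls_subdegree ?A..N}. fls_nth ?A n * (z - 0) powi n))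
      \<in> o[at 0 within S](\<lambda>z. (z - 0) powi N)"
    unfolding partial unfolding remainder diff_zero .
qed

section \<open>The sectors and reflection in the origin\<close>

lemma zero_islimpt_right_sector:
  assumes "\<delta> \<in> {0<..<pi/2}"
  shows "0 islimpt right_sector \<delta>"
  unfolding islimpt_approachable
proof (intro allI impI)
  fix e :: real assume "e > 0"
  then have "Arg (of_real (e / 2)) = 0" by (subst Arg_of_real) simp
  then show "\<exists>x\<in>right_sector \<delta>. x \<noteq> 0 \<and> dist x 0 < e"
    using assms \<open>e > 0\<close>
    by (intro bexI[of _ "of_real (e / 2)"]) (auto simp: right_sector_def simp del: of_real_divide)
qed

lemma left_sector_eq: "left_sector \<delta> = uminus ` right_sector \<delta>"
proof (intro equalityI subsetI)
  fix z assume "z \<in> left_sector \<delta>"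
  then show "z \<in> uminus ` right_sector \<delta>"
    by (intro image_eqI[of _ _ "-z"]) (auto simp: left_sector_def right_sector_def)
qed (auto simp: left_sector_def right_sector_def)

lemma zero_islimpt_left_sector:
  assumes "\<delta> \<in> {0<..<pi/2}"
  shows "0 islimpt left_sector \<delta>"
  using zero_islimpt_right_sector[OF assms] unfolding left_sector_eq islimpt_approachable
  by (metis (no_types, lifting) dist_0_norm dist_commute image_eqI neg_equal_0_iff_equal norm_minus_cancel)

lemma flat_on_uminus_image:
  assumes "flat_on S r"
  shows "flat_on (uminus ` S) (\<lambda>z. r (- z))"
  unfolding flat_on_def
proof
  fix N :: int
  have lim: "filterlim uminus (at 0 within S) (at 0 within uminus ` S :: complex filter)"
    unfolding filterlim_at
    by (auto simp: eventually_at_filter intro!: tendsto_eq_intros always_eventually)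
  have "r \<in> o[at 0 within S](\<lambda>z. z powi N)"
    using assms by (simp add: flat_on_def)
  from landau_o.small.compose[OF this lim]
  have "(\<lambda>z. r (- z)) \<in> o[at 0 within uminus ` S](\<lambda>z. (- z) powi N)" .
  also have "(\<lambda>z::complex. (- z) powi N) \<in> O[at 0 within uminus ` S](\<lambda>z. z powi N)"
    by (rule bigoI[where c = 1]) (simp add: norm_power_int)
  finally show "(\<lambda>z. r (- z)) \<in> o[at 0 within uminus ` S](\<lambda>z. z powi N)" .
qed

lemma Union_thermal_sectors: "\<Union> thermal_sectors = D_thermal"
proof -
  have right: "(\<exists>\<delta>\<in>{0<..<pi/2}. z \<in> right_sector \<delta>) \<longleftrightarrow> Re z > 0" for z :: complex
  proof
    assume "Re z > 0"
    then have "z \<noteq> 0" "\<bar>Arg z\<bar> < pi / 2" using Arg_Re_pos[of z] by auto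
    \<comment> \<open>The witness is half of the gap between |Arg z| and pi / 2.\<close>
    then show "\<exists>\<delta>\<in>{0<..<pi/2}. z \<in> right_sector \<delta>"
      by (intro bexI[of _ "(pi / 2 - \<bar>Arg z\<bar>) / 2"]) (auto simp: right_sector_def field_simps)
  next
    assume "\<exists>\<delta>\<in>{0<..<pi/2}. z \<in> right_sector \<delta>"
    then have "z \<noteq> 0" "\<bar>Arg z\<bar> < pi / 2" by (auto simp: right_sector_def)
    then show "Re z > 0" using Arg_Re_pos by blast
  qed
  have left: "z \<in> left_sector \<delta> \<longleftrightarrow> - z \<in> right_sector \<delta>" for z \<delta>
    by (simp add: left_sector_def right_sector_def)
  have "z \<in> \<Union> thermal_sectors \<longleftrightarrow> Re z > 0 \<or> Re (- z) > 0" for z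
    unfolding right[symmetric] by (auto simp: thermal_sectors_def left)
  then show ?thesis by (intro set_eqI) (auto simp: D_thermal_def)
qed

definition even_part_poly :: "complex poly \<Rightarrow> complex poly" where
  "even_part_poly P = smult (1 / 2) (P + pcompose P [:0, -1:])"

text \<open>Evenness of \<open>f\<close> turns its expansion \<open>P\<close> on the right into \<open>P (- z)\<close> on the left; the
  coefficients on which the two agree are those of even index.\<close>

lemma even_function_distillate:
  assumes even: "\<And>z. f (- z) = f z"
    and flat: "\<And>\<delta>. \<delta> \<in> {0<..<pi/2} \<Longrightarrow> flat_on (right_sector \<delta>) (\<lambda>z. f z - poly P z)"
  shows "has_analytic_distillate f D_thermal thermal_sectors 0 (poly (even_part_poly P))"
proof -
  define P' where "P' = pcompose P [:0, -1:]"
  have coeff_P': "coeff P' n = (-1) ^ n * coeff P n" for n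
    by (simp add: P'_def coeff_pcompose_linear)
  \<comment> \<open>Membership of 1 tells the two kinds of sector apart: it lies in every right
    sector, while \<open>Arg (- 1) = pi\<close> keeps it out of every left one.\<close>
  define A where "A S = fps_to_fls (fps_of_poly (if 1 \<in> S then P else P'))" for S :: "complex set"
  have A_right: "A (right_sector \<delta>) = fps_to_fls (fps_of_poly P)" if "\<delta> \<in> {0<..<pi/2}" for \<delta>
    using that by (simp add: A_def right_sector_def)
  have A_left: "A (left_sector \<delta>) = fps_to_fls (fps_of_poly P')" if "\<delta> \<in> {0<..<pi/2}" for \<delta>
  proof -
    have "Arg (- 1) = pi" using Arg_of_real[of "-1"] by simp
    then show ?thesis using that by (auto simp: A_def left_sector_def)
  qed
  have series: "has_asymptotic_series f (A S) 0 S" if "S \<in> thermal_sectors" for S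
    using that unfolding thermal_sectors_def
  proof (elim UnE imageE)
    fix \<delta> assume \<delta>: "\<delta> \<in> {0<..<pi/2}" and S: "S = right_sector \<delta>"
    show ?thesis unfolding S A_right[OF \<delta>]
      by (intro poly_has_asymptotic_series zero_islimpt_right_sector flat \<delta>)
  next
    fix \<delta> assume \<delta>: "\<delta> \<in> {0<..<pi/2}" and S: "S = left_sector \<delta>"
    have "flat_on (left_sector \<delta>) (\<lambda>z. f (- z) - poly P (- z))"
      unfolding left_sector_eq by (rule flat_on_uminus_image[OF flat[OF \<delta>]])
    then have "flat_on (left_sector \<delta>) (\<lambda>z. f z - poly P' z)"
      by (simp add: even P'_def poly_pcompose)
    then show ?thesis unfolding S A_left[OF \<delta>]
      by (intro poly_has_asymptotic_series zero_islimpt_left_sector \<delta>)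
  qed
  \<comment> \<open>One sector of each kind suffices to detect disagreement; 1 is an admissible
    angle because pi > 3.\<close>
  have in_sectors: "right_sector 1 \<in> thermal_sectors" "left_sector 1 \<in> thermal_sectors"
    using pi_gt3 by (auto simp: thermal_sectors_def)
  have A_cases: "A S = fps_to_fls (fps_of_poly P) \<or> A S = fps_to_fls (fps_of_poly P')" for S
    by (simp add: A_def)
  have A_values: "A (right_sector 1) = fps_to_fls (fps_of_poly P)"
    "A (left_sector 1) = fps_to_fls (fps_of_poly P')"
    using pi_gt3 by (auto intro!: A_right A_left)
  have "common_coeffs thermal_sectors A = fps_of_poly (even_part_poly P)"
  proof (rule fps_ext)
    fix n
    have E: "coeff (even_part_poly P) n = (if even n then coeff P n else 0)"
      by (simp add: even_part_poly_def coeff_P'[unfolded P'_def])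
    have nth: "fls_nth (A S) (int n) = coeff P n \<or> fls_nth (A S) (int n) = (-1) ^ n * coeff P n" for S
      using A_cases[of S] by (auto simp: coeff_P')
    have agree: "(\<forall>S\<in>thermal_sectors. \<forall>S'\<in>thermal_sectors. fls_nth (A S) (int n) = fls_nth (A S') (int n))
        \<longleftrightarrow> coeff P n = (-1) ^ n * coeff P n"
    proof
      assume "\<forall>S\<in>thermal_sectors. \<forall>S'\<in>thermal_sectors. fls_nth (A S) (int n) = fls_nth (A S') (int n)"
      then have "fls_nth (A (right_sector 1)) (int n) = fls_nth (A (left_sector 1)) (int n)"
        using in_sectors by blast
      then show "coeff P n = (-1) ^ n * coeff P n" by (simp add: A_values coeff_P')
    next
      assume "coeff P n = (-1) ^ n * coeff P n"
      then show "\<forall>S\<in>thermal_sectors. \<forall>S'\<in>thermal_sectors. fls_nth (A S) (int n) = fls_nth (A S') (int n)"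
        using nth by metis
    qed
    have "fps_nth (common_coeffs thermal_sectors A) n =
        (if coeff P n = (-1) ^ n * coeff P n then fls_nth (A (SOME S. S \<in> thermal_sectors)) (int n) else 0)"
      by (simp only: common_coeffs_def fps_nth_Abs_fps agree)
    \<comment> \<open>For even \<open>n\<close> all sectors share the coefficient, whichever one
      \<open>SOME\<close> picks; for odd \<open>n\<close> agreement forces
      \<open>coeff P n = 0\<close>.\<close>
    also have "\<dots> = coeff (even_part_poly P) n"
      unfolding E using nth[of "SOME S. S \<in> thermal_sectors"] by (cases "even n") auto
    finally show "fps_nth (common_coeffs thermal_sectors A) n = fps_nth (fps_of_poly (even_part_poly P)) n"
      by simp
  qed
  moreover have "0 \<in> closure D_thermal"
  proof -
    have "0 islimpt right_sector 1"
      using pi_gt3 by (intro zero_islimpt_right_sector) auto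
    moreover have "right_sector 1 \<subseteq> D_thermal"
      using in_sectors(1) Union_thermal_sectors by blast
    ultimately have "0 islimpt D_thermal"
      by (rule islimpt_subset)
    then show ?thesis by (simp add: closure_def)
  qed
  ultimately show ?thesis
    unfolding has_analytic_distillate_def
    by (intro conjI exI[of _ A]) (auto simp: Union_thermal_sectors series)
qed

section \<open>The thermal functions\<close>

text \<open>For the pressure, cosh (2 w) = 1 + 2 sinh^2 w with w = n \<phi> / 2 splits each summand
  into inverse fourth and second powers; convergence of both series for \<open>Re \<phi> > 0\<close>
  lets the sum be split.\<close>

lemma sum_csch_right:
  assumes "Re \<phi> > 0"
  shows "rho_I T0 \<phi> = of_real (T0 ^ 4 / (16 * pi\<^sup>2)) * (3 * (\<phi> ^ 4 * csch_sum 4 \<phi>))"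
    and "p_I T0 \<phi> = of_real (T0 ^ 4 / (16 * pi\<^sup>2)) *
           (\<phi> ^ 4 * csch_sum 4 \<phi> + 2 * \<phi> ^ 2 * (\<phi> ^ 2 * csch_sum 2 \<phi>))"
    and "A_I T0 \<phi> = of_real (T0 ^ 4 / (16 * pi\<^sup>2)) * (2 * (\<phi> ^ 2 * csch_sum 2 \<phi>))"
proof -
  have s2: "(\<lambda>n. 1 / sinh (of_nat (Suc n) * \<phi> / 2) ^ 2) sums csch_sum 2 \<phi>"
    and s4: "(\<lambda>n. 1 / sinh (of_nat (Suc n) * \<phi> / 2) ^ 4) sums csch_sum 4 \<phi>"
    by (intro csch_sums assms; simp)+
  have "(\<Sum>n. 3 * \<phi> ^ 4 * (1 / sinh (of_nat (Suc n) * \<phi> / 2) ^ 4)) = 3 * \<phi> ^ 4 * csch_sum 4 \<phi>"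
    by (rule sums_unique[symmetric, OF sums_mult[OF s4]])
  then show "rho_I T0 \<phi> = of_real (T0 ^ 4 / (16 * pi\<^sup>2)) * (3 * (\<phi> ^ 4 * csch_sum 4 \<phi>))"
    by (simp add: rho_I_def Let_def mult.assoc)
  have "(\<Sum>n. 2 * \<phi> ^ 2 * (1 / sinh (of_nat (Suc n) * \<phi> / 2) ^ 2)) = 2 * \<phi> ^ 2 * csch_sum 2 \<phi>"
    by (rule sums_unique[symmetric, OF sums_mult[OF s2]])
  then show "A_I T0 \<phi> = of_real (T0 ^ 4 / (16 * pi\<^sup>2)) * (2 * (\<phi> ^ 2 * csch_sum 2 \<phi>))"
    by (simp add: A_I_def Let_def mult.assoc)
  have termwise: "\<phi> ^ 4 * (1 / sinh (of_nat (Suc n) * \<phi> / 2) ^ 4) +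
      2 * \<phi> ^ 4 * (1 / sinh (of_nat (Suc n) * \<phi> / 2) ^ 2) =
      \<phi> ^ 4 * cosh (of_nat (Suc n) * \<phi>) / sinh (of_nat (Suc n) * \<phi> / 2) ^ 4" for n
  proof -
    define w where "w = of_nat (Suc n) * \<phi> / 2"
    have "Re w > 0" using assms by (simp add: w_def)
    then have "sinh w \<noteq> 0" using norm_sinh_ge_power[of w 1] by auto
    moreover have "cosh (of_nat (Suc n) * \<phi>) = 1 + 2 * sinh w ^ 2"
      using cosh_double[of w] cosh_square_eq[of w] by (simp add: w_def)
    ultimately show ?thesis
      unfolding w_def[symmetric] by (simp add: field_simps power_numeral_reduce)
  qed
  have "(\<Sum>n. \<phi> ^ 4 * (1 / sinh (of_nat (Suc n) * \<phi> / 2) ^ 4) +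
      2 * \<phi> ^ 4 * (1 / sinh (of_nat (Suc n) * \<phi> / 2) ^ 2)) =
      \<phi> ^ 4 * csch_sum 4 \<phi> + 2 * \<phi> ^ 4 * csch_sum 2 \<phi>"
    by (rule sums_unique[symmetric, OF sums_add[OF sums_mult[OF s4] sums_mult[OF s2]]])
  then show "p_I T0 \<phi> = of_real (T0 ^ 4 / (16 * pi\<^sup>2)) *
           (\<phi> ^ 4 * csch_sum 4 \<phi> + 2 * \<phi> ^ 2 * (\<phi> ^ 2 * csch_sum 2 \<phi>))"
    unfolding termwise by (simp add: p_I_def Let_def power_numeral_reduce)
qed

lemma thermal_sums_even: "rho_I T0 (- \<phi>) = rho_I T0 \<phi>" "p_I T0 (- \<phi>) = p_I T0 \<phi>" "A_I T0 (- \<phi>) = A_I T0 \<phi>"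
  by (simp_all add: rho_I_def p_I_def A_I_def Let_def)

text \<open>What remains of \<open>csch_sum_2_inversion\<close> once the flat dual sums are
  dropped.\<close>

definition csch2_poly :: "complex poly" where
  "csch2_poly = [:2 * pi\<^sup>2 / 3, -2, 1 / 6:]"

definition csch4_poly :: "complex poly" where
  "csch4_poly = [:8 * pi ^ 4 / 45, 0, - 4 * pi\<^sup>2 / 9, 4 / 3, - 11 / 90:]"

lemma Re_right_sector:
  assumes "z \<in> right_sector \<delta>" "\<delta> \<in> {0<..<pi/2}"
  shows "Re z > 0"
  using assms Arg_Re_pos[of z] by (auto simp: right_sector_def)

lemma csch_sum_asymptotics:
  assumes \<delta>: "\<delta> \<in> {0<..<pi/2}"
  shows "flat_on (right_sector \<delta>) (\<lambda>z. z ^ 2 * csch_sum 2 z - poly csch2_poly z)"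
    and "flat_on (right_sector \<delta>) (\<lambda>z. z ^ 4 * csch_sum 4 z - poly csch4_poly z)"
proof -
  note flat = flat_on_csch_sum_dual[OF \<delta>, of 2, simplified] flat_on_csch_sum_dual[OF \<delta>, of 4, simplified]
  have "flat_on (right_sector \<delta>) (\<lambda>z. - 4 * pi\<^sup>2 * csch_sum 2 (4 * pi\<^sup>2 / z))"
    using flat_on_cmult[OF flat(1), of "- 4 * pi\<^sup>2"] by simp
  then show "flat_on (right_sector \<delta>) (\<lambda>z. z ^ 2 * csch_sum 2 z - poly csch2_poly z)"
    by (rule flat_on_cong)
       (use csch_sum_2_inversion[OF Re_right_sector[OF _ \<delta>]] in
         \<open>simp add: csch2_poly_def algebra_simps power2_eq_square\<close>)
  have "flat_on (right_sector \<delta>) (\<lambda>z.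
      16 * pi ^ 4 * (csch_sum 4 (4 * pi\<^sup>2 / z) + 2 / 3 * csch_sum 2 (4 * pi\<^sup>2 / z)) +
      8 * pi\<^sup>2 / 3 * (z ^ 2 * csch_sum 2 (4 * pi\<^sup>2 / z)))"
    using flat by (intro flat_on_add flat_on_cmult flat_on_power_mult) simp_all
  then show "flat_on (right_sector \<delta>) (\<lambda>z. z ^ 4 * csch_sum 4 z - poly csch4_poly z)"
    by (rule flat_on_cong)
       (use csch_sum_4_inversion[OF Re_right_sector[OF _ \<delta>]] in
         \<open>simp add: csch4_poly_def algebra_simps power_numeral_reduce\<close>)
qed

text \<open>The factor \<open>monom 2 2\<close>, that is 2 \<phi>^2, comes from the inverse squares
  in the pressure.\<close>

lemma thermal_distillates:
  fixes T0 :: real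
  defines "c \<equiv> complex_of_real (T0 ^ 4 / (16 * pi\<^sup>2))"
  shows "has_analytic_distillate (rho_I T0) D_thermal thermal_sectors 0
           (poly (even_part_poly (smult (3 * c) csch4_poly)))"
    and "has_analytic_distillate (p_I T0) D_thermal thermal_sectors 0
           (poly (even_part_poly (smult c (csch4_poly + monom 2 2 * csch2_poly))))"
    and "has_analytic_distillate (A_I T0) D_thermal thermal_sectors 0
           (poly (even_part_poly (smult (2 * c) csch2_poly)))"
proof -
  show "has_analytic_distillate (rho_I T0) D_thermal thermal_sectors 0
           (poly (even_part_poly (smult (3 * c) csch4_poly)))"
  proof (rule even_function_distillate, rule thermal_sums_even(1))
    fix \<delta> assume \<delta>: "\<delta> \<in> {0<..<pi/2}"
    show "flat_on (right_sector \<delta>) (\<lambda>z. rho_I T0 z - poly (smult (3 * c) csch4_poly) z)"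
      by (rule flat_on_cong[OF flat_on_cmult[OF csch_sum_asymptotics(2)[OF \<delta>], of "3 * c"]])
         (simp add: sum_csch_right(1)[where ?T0.0 = T0, OF Re_right_sector[OF _ \<delta>], folded c_def] algebra_simps)
  qed
  show "has_analytic_distillate (A_I T0) D_thermal thermal_sectors 0
           (poly (even_part_poly (smult (2 * c) csch2_poly)))"
  proof (rule even_function_distillate, rule thermal_sums_even(3))
    fix \<delta> assume \<delta>: "\<delta> \<in> {0<..<pi/2}"
    show "flat_on (right_sector \<delta>) (\<lambda>z. A_I T0 z - poly (smult (2 * c) csch2_poly) z)"
      by (rule flat_on_cong[OF flat_on_cmult[OF csch_sum_asymptotics(1)[OF \<delta>], of "2 * c"]])
         (simp add: sum_csch_right(3)[where ?T0.0 = T0, OF Re_right_sector[OF _ \<delta>], folded c_def] algebra_simps)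
  qed
  show "has_analytic_distillate (p_I T0) D_thermal thermal_sectors 0
           (poly (even_part_poly (smult c (csch4_poly + monom 2 2 * csch2_poly))))"
  proof (rule even_function_distillate, rule thermal_sums_even(2))
    fix \<delta> assume \<delta>: "\<delta> \<in> {0<..<pi/2}"
    have "flat_on (right_sector \<delta>) (\<lambda>z. c * (z ^ 4 * csch_sum 4 z - poly csch4_poly z) +
            2 * c * (z ^ 2 * (z ^ 2 * csch_sum 2 z - poly csch2_poly z)))"
      by (intro flat_on_add flat_on_cmult flat_on_power_mult csch_sum_asymptotics \<delta>)
    then show "flat_on (right_sector \<delta>)
        (\<lambda>z. p_I T0 z - poly (smult c (csch4_poly + monom 2 2 * csch2_poly)) z)"
      by (rule flat_on_cong)
         (simp add: sum_csch_right(2)[where ?T0.0 = T0, OF Re_right_sector[OF _ \<delta>], folded c_def] poly_monom algebra_simps)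
  qed
qed

lemma poly_even_part: "poly (even_part_poly P) z = (poly P z + poly P (- z)) / 2"
  by (simp add: even_part_poly_def poly_pcompose)

theorem mainTheorem9:
  fixes T0 :: real
  assumes "T0 > 0"
  shows "\<exists>P\<^sub>\<rho> P\<^sub>p P\<^sub>A :: complex poly.
     has_analytic_distillate (rho_I T0) D_thermal thermal_sectors 0 (poly P\<^sub>\<rho>) \<and>
     has_analytic_distillate (p_I T0) D_thermal thermal_sectors 0 (poly P\<^sub>p) \<and>
     has_analytic_distillate (A_I T0) D_thermal thermal_sectors 0 (poly P\<^sub>A) \<and>
     (\<forall>a::real.
        poly P\<^sub>\<rho> (\<i> * of_real (a / T0)) =
          of_real (T0 ^ 4 * (pi\<^sup>2 / 30 + a\<^sup>2 / (12 * T0\<^sup>2) - 11 * a ^ 4 / (480 * pi\<^sup>2 * T0 ^ 4))) \<and>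
        poly P\<^sub>p (\<i> * of_real (a / T0)) =
          of_real (T0 ^ 4 * (pi\<^sup>2 / 90 - a\<^sup>2 / (18 * T0\<^sup>2) + 19 * a ^ 4 / (1440 * pi\<^sup>2 * T0 ^ 4))) \<and>
        poly P\<^sub>A (\<i> * of_real (a / T0)) =
          of_real (T0 ^ 4 * (1 / 12 - a\<^sup>2 / (48 * pi\<^sup>2 * T0\<^sup>2))) \<and>
        (a / T0 = 2 * pi \<longrightarrow>
           poly P\<^sub>\<rho> (\<i> * of_real (a / T0)) = 0 \<and>
           poly P\<^sub>p (\<i> * of_real (a / T0)) = 0 \<and>
           poly P\<^sub>A (\<i> * of_real (a / T0)) = 0))"
proof -
  define c where "c = complex_of_real (T0 ^ 4 / (16 * pi\<^sup>2))"
  let ?R = "even_part_poly (smult (3 * c) csch4_poly)"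
  let ?P = "even_part_poly (smult c (csch4_poly + monom 2 2 * csch2_poly))"
  let ?A = "even_part_poly (smult (2 * c) csch2_poly)"
  have R: "poly ?R (\<i> * of_real x) = of_real
      (T0 ^ 4 / (16 * pi\<^sup>2) * (3 * (8 * pi ^ 4 / 45 + 4 * pi\<^sup>2 / 9 * x\<^sup>2 - 11 / 90 * x ^ 4)))" for x
    by (simp add: poly_even_part csch4_poly_def c_def field_simps power_numeral_reduce)
  have P: "poly ?P (\<i> * of_real x) = of_real
      (T0 ^ 4 / (16 * pi\<^sup>2) * (8 * pi ^ 4 / 45 + 4 * pi\<^sup>2 / 9 * x\<^sup>2 - 11 / 90 * x ^ 4
         - 2 * x\<^sup>2 * (2 * pi\<^sup>2 / 3 - x\<^sup>2 / 6)))" for x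
    by (simp add: poly_even_part csch4_poly_def csch2_poly_def c_def poly_monom field_simps
        power_numeral_reduce)
  have A: "poly ?A (\<i> * of_real x) = of_real
      (T0 ^ 4 / (16 * pi\<^sup>2) * (2 * (2 * pi\<^sup>2 / 3 - x\<^sup>2 / 6)))" for x
    by (simp add: poly_even_part csch2_poly_def c_def field_simps power_numeral_reduce)
  have vals: "poly ?R (\<i> * of_real (a / T0)) =
          of_real (T0 ^ 4 * (pi\<^sup>2 / 30 + a\<^sup>2 / (12 * T0\<^sup>2) - 11 * a ^ 4 / (480 * pi\<^sup>2 * T0 ^ 4)))"
      "poly ?P (\<i> * of_real (a / T0)) =
          of_real (T0 ^ 4 * (pi\<^sup>2 / 90 - a\<^sup>2 / (18 * T0\<^sup>2) + 19 * a ^ 4 / (1440 * pi\<^sup>2 * T0 ^ 4)))"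
      "poly ?A (\<i> * of_real (a / T0)) =
          of_real (T0 ^ 4 * (1 / 12 - a\<^sup>2 / (48 * pi\<^sup>2 * T0\<^sup>2)))" for a
    unfolding R P A of_real_eq_iff
    using assms by (simp_all add: field_simps power_numeral_reduce)
  \<comment> \<open>The even parts are combinations of 2 pi^2 / 3 + \<phi>^2 / 6 and 16 pi^4 -
    \<phi>^4, and both vanish at \<phi> = 2 pi i. There \<open>t = -1\<close>, and
    \<open>zeta_even m / t ^ m - zeta_even m\<close> is 0.\<close>
  have zeros: "poly ?R (\<i> * of_real (2 * pi)) = 0" "poly ?P (\<i> * of_real (2 * pi)) = 0"
      "poly ?A (\<i> * of_real (2 * pi)) = 0"
    unfolding R P A of_real_eq_0_iff by (simp_all add: power_mult_distrib power_numeral_reduce)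
  show ?thesis
  proof (intro exI conjI allI impI)
    show "has_analytic_distillate (rho_I T0) D_thermal thermal_sectors 0 (poly ?R)"
      "has_analytic_distillate (p_I T0) D_thermal thermal_sectors 0 (poly ?P)"
      "has_analytic_distillate (A_I T0) D_thermal thermal_sectors 0 (poly ?A)"
      unfolding c_def by (rule thermal_distillates)+
    fix a :: real
    show "poly ?R (\<i> * of_real (a / T0)) =
          of_real (T0 ^ 4 * (pi\<^sup>2 / 30 + a\<^sup>2 / (12 * T0\<^sup>2) - 11 * a ^ 4 / (480 * pi\<^sup>2 * T0 ^ 4)))"
      "poly ?P (\<i> * of_real (a / T0)) =
          of_real (T0 ^ 4 * (pi\<^sup>2 / 90 - a\<^sup>2 / (18 * T0\<^sup>2) + 19 * a ^ 4 / (1440 * pi\<^sup>2 * T0 ^ 4)))"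
      "poly ?A (\<i> * of_real (a / T0)) =
          of_real (T0 ^ 4 * (1 / 12 - a\<^sup>2 / (48 * pi\<^sup>2 * T0\<^sup>2)))"
      by (rule vals)+
    assume "a / T0 = 2 * pi"
    then show "poly ?R (\<i> * of_real (a / T0)) = 0" "poly ?P (\<i> * of_real (a / T0)) = 0"
      "poly ?A (\<i> * of_real (a / T0)) = 0"
      by (simp_all only: zeros)
  qed
qed

end
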